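(* Let $H$ be a real Hilbert space of finite dimension $d$, let $M\subset H$ be a $k$-dimensional compact smooth submanifold-with-boundary ($1\le k\le d$), and let $\mathbf S\subset M$ satisfy $\mathrm{dem}(\mathbf S)=k$. Then $\mathbf S$ has nonempty interior relative to $M$.
   Context: Demension: for $S\subset H$, $\mathrm{dem}(S)$ is the largest integer $k$ such that there exist a piecewise linear polyhedron $P\subset H$ of dimension $d-k$ and $\epsilon>0$ such that for every continuous $F:H\times[0,1]\to H$ with (I) each $F_t=F(\cdot,t)$ a homeomorphism and $F_0=\mathrm{id}$, (II) $\sup_x\|F_t(x)-x\|\le\epsilon$ for all $t$, (III) $F_t(x)=x$ for all $t$ and all $x\notin N(P\cap S,\epsilon)=\{x:\mathrm{dist}(x,P\cap S)<\epsilon\}$, one has $F_1(P)\cap S\ne\emptyset$. *)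

theory Defs
  imports "HOL-Analysis.Analysis"
begin

text \<open>C^n and C^infinity maps on an open set U of a finite-dimensional real inner product space.
  C^(n+1): differentiable on U and every directional derivative x |-> Df(x) v is C^n
  (in finite dimension this is the usual definition via the derivative map into L(H,H)).\<close>

fun Cn_on :: "nat \<Rightarrow> 'a::euclidean_space set \<Rightarrow> ('a \<Rightarrow> 'b::euclidean_space) \<Rightarrow> bool" where
  "Cn_on 0 U f = continuous_on U f"
| "Cn_on (Suc n) U f =
     (f differentiable_on U \<and> (\<forall>v. Cn_on n U (\<lambda>x. frechet_derivative f (at x) v)))"

definition smooth_on :: "'a::euclidean_space set \<Rightarrow> ('a \<Rightarrow> 'b::euclidean_space) \<Rightarrow> bool" where
  "smooth_on U f \<longleftrightarrow> (\<forall>n. Cn_on n U f)"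

definition diffeo_between :: "'a::euclidean_space set \<Rightarrow> 'a set \<Rightarrow> ('a \<Rightarrow> 'a) \<Rightarrow> ('a \<Rightarrow> 'a) \<Rightarrow> bool" where
  "diffeo_between U V \<phi> \<psi> \<longleftrightarrow>
     open U \<and> open V \<and> homeomorphism U V \<phi> \<psi> \<and> smooth_on U \<phi> \<and> smooth_on V \<psi>"

definition submanifold_with_boundary :: "nat \<Rightarrow> 'a::euclidean_space set \<Rightarrow> bool" where
  "submanifold_with_boundary k M \<longleftrightarrow>
     (\<forall>p\<in>M. \<exists>U V \<phi> \<psi> E e.
        p \<in> U \<and> diffeo_between U V \<phi> \<psi> \<and>
        subspace E \<and> dim E = k \<and> e \<in> E \<and> e \<noteq> 0 \<and>
        \<phi> ` (U \<inter> M) = V \<inter> {y \<in> E. y \<bullet> e \<ge> 0})"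

definition pl_polyhedron_dim :: "'a::euclidean_space set \<Rightarrow> int \<Rightarrow> bool" where
  "pl_polyhedron_dim P m \<longleftrightarrow>
     (\<exists>\<T>. finite \<T> \<and> P = \<Union>\<T> \<and> (\<forall>T\<in>\<T>. \<exists>n\<le>m. n simplex T) \<and> (\<exists>T\<in>\<T>. m simplex T))"

definition nbhd :: "'a::metric_space set \<Rightarrow> real \<Rightarrow> 'a set" where
  "nbhd A \<epsilon> = {x. \<exists>y\<in>A. dist x y < \<epsilon>}"

definition admissible_isotopy :: "'a::euclidean_space set \<Rightarrow> 'a set \<Rightarrow> real \<Rightarrow> ('a \<Rightarrow> real \<Rightarrow> 'a) \<Rightarrow> bool" where
  "admissible_isotopy P S \<epsilon> F \<longleftrightarrow>
     continuous_on (UNIV \<times> {0..1}) (\<lambda>(x,t). F x t) \<and>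
     (\<forall>t\<in>{0..1}. \<exists>g. homeomorphism UNIV UNIV (\<lambda>x. F x t) g) \<and>
     (\<forall>x. F x 0 = x) \<and>
     (\<forall>t\<in>{0..1}. \<forall>x. norm (F x t - x) \<le> \<epsilon>) \<and>
     (\<forall>t\<in>{0..1}. \<forall>x. x \<notin> nbhd (P \<inter> S) \<epsilon> \<longrightarrow> F x t = x)"

definition dem_prop :: "'a::euclidean_space set \<Rightarrow> int \<Rightarrow> bool" where
  "dem_prop S k \<longleftrightarrow>
     (\<exists>P \<epsilon>. pl_polyhedron_dim P (int DIM('a) - k) \<and> \<epsilon> > 0 \<and>
        (\<forall>F. admissible_isotopy P S \<epsilon> F \<longrightarrow> (\<lambda>x. F x 1) ` P \<inter> S \<noteq> {}))"

definition dem_eq :: "'a::euclidean_space set \<Rightarrow> int \<Rightarrow> bool" where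
  "dem_eq S k \<longleftrightarrow> dem_prop S k \<and> (\<forall>j. dem_prop S j \<longrightarrow> j \<le> k)"

end

theory Submission
  imports Defs
begin

text \<open>
Suppose \<open>S\<close> has empty interior in \<open>M\<close>, and let \<open>P\<close> be a polyhedron of dimension \<open>d - k\<close>. Take a cutoff
\<open>\<beta>\<close> that is positive exactly on an open set \<open>W\<close> around \<open>P \<inter> S\<close>, and move \<open>P\<close> by \<open>x \<mapsto> x + \<beta> x *\<^sub>R v\<close>
with \<open>v\<close> small. A point \<open>x\<close> of \<open>P \<inter> W\<close> lands on \<open>m \<in> M\<close> iff \<open>v = (m - x) / \<beta> x\<close>, and \<open>(m, x)\<close> ranges over a
\<open>d\<close>-dimensional space. By the easy case of Sard's theorem, for almost every \<open>v\<close> all solutions are isolated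
and have \<open>m\<close> off the boundary of \<open>M\<close>. The moved polyhedron then meets \<open>M\<close> inside \<open>W\<close> in a discrete set, which
may accumulate at the frontier of \<open>W\<close>. In disjoint balls around these points, homeomorphisms
that preserve \<open>M\<close> push them into \<open>M - S\<close>, which is dense in \<open>M\<close>; the radii of the balls tend to \<open>0\<close>,
so that the pushes fit together to one isotopy. Outside \<open>W\<close> nothing moves and \<open>P\<close> misses \<open>S\<close> already.
\<close>

section \<open>Critical values of maps between Euclidean spaces\<close>

text \<open>
The library states Sard's theorem for \<open>real^'n\<close> with a well-ordered index type only. This type
serves as \<open>'n\<close> for an arbitrary Euclidean space.
\<close>

typedef (overloaded) ('a::euclidean_space) coord_index = "{..<DIM('a)}"
  by (metis DIM_positive empty_iff lessThan_iff equals0I)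

instantiation coord_index :: (euclidean_space) wellorder
begin

definition less_eq_coord_index :: "'a coord_index \<Rightarrow> 'a coord_index \<Rightarrow> bool"
  where "less_eq_coord_index i j \<longleftrightarrow> Rep_coord_index i \<le> Rep_coord_index j"
definition less_coord_index :: "'a coord_index \<Rightarrow> 'a coord_index \<Rightarrow> bool"
  where "less_coord_index i j \<longleftrightarrow> Rep_coord_index i < Rep_coord_index j"

instance
proof
  fix P :: "'a coord_index \<Rightarrow> bool" and i
  assume step: "\<And>i. (\<And>j. j < i \<Longrightarrow> P j) \<Longrightarrow> P i"
  show "P i"
    by (induction i rule: measure_induct_rule[of Rep_coord_index])
       (auto intro: step simp: less_coord_index_def)
qed (auto simp: less_eq_coord_index_def less_coord_index_def Rep_coord_index_inject)

end

lemma CARD_coord_index: "CARD('a::euclidean_space coord_index) = DIM('a)"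
  using type_definition.card[OF type_definition_coord_index] by simp

instance coord_index :: (euclidean_space) finite
proof
  show "finite (UNIV :: 'a coord_index set)"
    by (metis CARD_coord_index DIM_positive card_ge_0_finite)
qed

text \<open>Conjugation with a linear isomorphism \<open>g\<close> onto
  \<open>real^'a coord_index\<close> reduces this to \<open>baby_Sard\<close>: a non-injective
  derivative has a matrix of less than full rank, and the linear map \<open>h\<close> takes null
  sets back to null sets.\<close>

lemma negligible_critical_values:
  fixes f :: "'a::euclidean_space \<Rightarrow> 'a"
  assumes der: "\<And>x. x \<in> S \<Longrightarrow> (f has_derivative f' x) (at x within S)"
    and sing: "\<And>x. x \<in> S \<Longrightarrow> \<not> inj (f' x)"
  shows "negligible (f ` S)"
proof -
  have "DIM('a) = DIM(real^'a coord_index)"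
    by (simp add: CARD_coord_index)
  then obtain g :: "'a \<Rightarrow> real^'a coord_index" and h
    where g: "linear g" and h: "linear h" and hg: "\<And>x. h (g x) = x" and gh: "\<And>y. g (h y) = y"
    using isomorphisms_UNIV_UNIV by metis
  define F where "F = g \<circ> f \<circ> h"
  define F' where "F' = (\<lambda>y. g \<circ> f' (h y) \<circ> h)"
  have hS: "h ` g ` S = S"
    by (simp add: image_comp hg comp_def)
  have der': "(F has_derivative F' y) (at y within g ` S)" if "y \<in> g ` S" for y
  proof -
    have "h y \<in> S"
      using that hg by auto
    have 1: "(h has_derivative h) (at y within g ` S)"
      using h linear_imp_has_derivative by blast
    have 2: "(f has_derivative f' (h y)) (at (h y) within h ` g ` S)"
      using der[OF \<open>h y \<in> S\<close>] hS by simp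
    have 3: "(g has_derivative g) (at ((f \<circ> h) y) within (f \<circ> h) ` g ` S)"
      using g linear_imp_has_derivative by blast
    have "(g \<circ> (f \<circ> h) has_derivative g \<circ> (f' (h y) \<circ> h)) (at y within g ` S)"
      by (rule diff_chain_within[OF diff_chain_within[OF 1 2] 3])
    then show ?thesis
      by (simp add: F_def F'_def o_assoc)
  qed
  have "negligible (F ` (g ` S))"
  proof (rule baby_Sard[OF _ der'])
    fix y assume y: "y \<in> g ` S"
    then have "h y \<in> S"
      using hg by auto
    have lin: "linear (F' y)"
      using der'[OF y] has_derivative_linear by blast
    have "\<not> inj (F' y)"
    proof
      assume inj: "inj (F' y)"
      have "f' (h y) = h \<circ> F' y \<circ> g"
        by (simp add: F'_def fun_eq_iff hg)
      moreover have "inj h" "inj g"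
        using gh hg by (metis injI)+
      ultimately have "inj (f' (h y))"
        using inj by (simp add: inj_compose)
      then show False
        using sing \<open>h y \<in> S\<close> by blast
    qed
    then show "rank (matrix (F' y)) < CARD('a coord_index)"
      unfolding less_rank_noninjective using matrix_vector_mul(2)[OF lin] by metis
  qed simp_all
  then have "negligible (h ` F ` g ` S)"
    by (rule negligible_differentiable_image_negligible[rotated])
       (auto simp: CARD_coord_index h linear_imp_differentiable_on)
  moreover have "h ` F ` g ` S = f ` S"
    by (simp add: image_comp F_def comp_def hg)
  ultimately show ?thesis
    by simp
qed

text \<open>An injective \<open>f'\<close> is bounded below,
  \<open>B * norm w \<le> norm (f' w)\<close> with \<open>B > 0\<close>. Near \<open>x\<close> the
  linearisation error is at most half of this bound, so equal values at \<open>x\<close> and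
  \<open>y\<close> force \<open>y = x\<close>.\<close>

lemma injective_derivative_imp_isolated:
  fixes f :: "'a::euclidean_space \<Rightarrow> 'b::euclidean_space"
  assumes "(f has_derivative f') (at x)" and "inj f'"
  obtains \<delta> where "\<delta> > 0" and "\<And>y. dist y x < \<delta> \<Longrightarrow> f y = f x \<Longrightarrow> y = x"
proof -
  have "linear f'"
    using assms(1) has_derivative_linear by blast
  then obtain B where B: "B > 0" "\<And>x. B * norm x \<le> norm (f' x)"
    using linear_inj_bounded_below_pos assms(2) by blast
  have "B / 2 > 0"
    using B by simp
  then obtain \<delta> where \<delta>: "\<delta> > 0"
      "\<And>y. norm (y - x) < \<delta> \<Longrightarrow> norm (f y - f x - f' (y - x)) \<le> B / 2 * norm (y - x)"
    using assms(1) unfolding has_derivative_at_alt by blast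
  show thesis
  proof
    fix y assume y: "dist y x < \<delta>" "f y = f x"
    then have "norm (f' (y - x)) \<le> B / 2 * norm (y - x)"
      using \<delta>(2)[of y] by (simp add: dist_norm)
    then have "B * norm (y - x) \<le> B / 2 * norm (y - x)"
      using B(2) order_trans by blast
    then show "y = x"
      using B(1) by (simp add: mult_le_cancel_right) 
  qed (use \<delta> in auto)
qed

text \<open>The exceptional set consists of the values at points of \<open>\<Omega>\<close> with
  non-injective derivative. The competing solution \<open>y\<close> ranges over the whole space, not
  only over \<open>\<Omega>\<close>.\<close>

lemma negligible_nonisolated_values:
  fixes G :: "'a::euclidean_space \<Rightarrow> 'a"
  assumes "\<And>z. z \<in> \<Omega> \<Longrightarrow> G differentiable (at z)"
  obtains N where "negligible N"
    and "\<And>z. z \<in> \<Omega> \<Longrightarrow> G z \<notin> N \<Longrightarrow> \<exists>\<delta>>0. \<forall>y. dist y z < \<delta> \<longrightarrow> G y = G z \<longrightarrow> y = z"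
proof -
  define D where "D = (\<lambda>z. frechet_derivative G (at z))"
  have D: "(G has_derivative D z) (at z)" if "z \<in> \<Omega>" for z
    using assms[OF that] unfolding D_def by (simp add: frechet_derivative_works)
  define N where "N = G ` {z \<in> \<Omega>. \<not> inj (D z)}"
  show thesis
  proof
    show "negligible N"
      unfolding N_def
      by (rule negligible_critical_values[where f' = D]) (auto intro: has_derivative_at_withinI D)
    fix z assume "z \<in> \<Omega>" "G z \<notin> N"
    then have "inj (D z)"
      by (auto simp: N_def)
    then show "\<exists>\<delta>>0. \<forall>y. dist y z < \<delta> \<longrightarrow> G y = G z \<longrightarrow> y = z"
      using injective_derivative_imp_isolated[OF D[OF \<open>z \<in> \<Omega>\<close>]] by metis
  qed
qed

section \<open>Generic intersections\<close>

text \<open>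
The point \<open>y + B (x - a)\<close> encodes a pair \<open>(y, x)\<close> with \<open>y \<in> E\<close> and \<open>x \<in> T\<close> in a single vector of
the ambient space; \<open>\<pi>\<close> and \<open>A\<close> decode it.
\<close>

lemma linear_coordinates_complement:
  fixes E T :: "'a::euclidean_space set"
  assumes E: "subspace E" and dim: "aff_dim T \<le> int DIM('a) - int (dim E)" and a: "a \<in> T"
  obtains \<pi> A B :: "'a \<Rightarrow> 'a" where "linear \<pi>" "linear A" "linear B"
    and "\<And>y x. y \<in> E \<Longrightarrow> x \<in> T \<Longrightarrow> \<pi> (y + B (x - a)) = y"
    and "\<And>x. x \<in> T \<Longrightarrow> A (B (x - a)) = x - a"
    and "\<And>y x. y \<in> E \<Longrightarrow> x \<in> T \<Longrightarrow> y \<bullet> B (x - a) = 0"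
proof -
  \<comment> \<open>The space \<open>L\<close> of directions of \<open>T\<close> has at most the
    dimension of the orthogonal complement \<open>E'\<close> of \<open>E\<close>, so an isometry
    \<open>B\<close> fits it into \<open>E'\<close>.\<close>
  define L where "L = span ((\<lambda>x. x - a) ` T)"
  define E' where "E' = {w \<in> UNIV. \<forall>y\<in>E. orthogonal y w}"
  have subE': "subspace E'"
    unfolding E'_def using subspace_orthogonal_to_vectors[of E] by simp
  have "dim E' + dim E = dim (UNIV :: 'a set)"
    unfolding E'_def by (rule dim_subspace_orthogonal_to_vectors) (use E in auto)
  moreover have "aff_dim T = int (dim L)"
    unfolding L_def dim_span
    using aff_dim_eq_dim_subtract[of a T] a hull_inc by metis
  ultimately have "dim L \<le> dim E'"
    using dim by simp
  then obtain B :: "'a \<Rightarrow> 'a" where B: "linear B" "B \<in> L \<rightarrow> E'" "\<And>x. x \<in> L \<Longrightarrow> norm (B x) = norm x"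
    using isometry_subset_subspace[of L E'] subE' unfolding L_def by auto
  have "subspace L"
    by (simp add: L_def)
  have inj: "inj_on B L"
    using B linear_injective_on_subspace_0[OF B(1) \<open>subspace L\<close>] by (metis norm_eq_zero)
  then obtain A where A: "linear A" "\<And>x. x \<in> L \<Longrightarrow> A (B x) = x"
    using linear_exists_left_inverse_on[OF B(1) \<open>subspace L\<close>] by blast
  obtain Q where Q: "Q \<subseteq> E" "pairwise orthogonal Q" "\<And>x. x \<in> Q \<Longrightarrow> norm x = 1"
      "independent Q" "span Q = E"
    using orthonormal_basis_subspace[OF E] by metis
  have "finite Q"
    using Q(4) independent_imp_finite by blast
  \<comment> \<open>The orthogonal projection onto \<open>E\<close>; it annihilates
    \<open>E'\<close>, where the vectors \<open>B (x - a)\<close> lie.\<close>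
  define \<pi> where "\<pi> = (\<lambda>z. \<Sum>i\<in>Q. (z \<bullet> i) *\<^sub>R i)"
  have "linear \<pi>"
    unfolding \<pi>_def
    by (intro linear_compose_sum ballI linearI) (auto simp: inner_add_left scaleR_add_left)
  have \<pi>_E: "\<pi> y = y" if "y \<in> E" for y
    unfolding \<pi>_def using orthonormal_basis_expand[OF Q(2,3) _ \<open>finite Q\<close>] that Q(5) by auto
  have BE': "B (x - a) \<in> E'" if "x \<in> T" for x
    using B(2) that by (auto simp: L_def intro: span_base)
  have \<pi>_E': "\<pi> w = 0" if "w \<in> E'" for w
    using that Q(1) unfolding \<pi>_def E'_def
    by (intro sum.neutral) (auto simp: orthogonal_def inner_commute)
  show thesis
  proof
    show "\<pi> (y + B (x - a)) = y" if "y \<in> E" "x \<in> T" for y x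
      using \<pi>_E[OF that(1)] \<pi>_E'[OF BE'[OF that(2)]] linear_add[OF \<open>linear \<pi>\<close>] by simp
    show "A (B (x - a)) = x - a" if "x \<in> T" for x
      using A(2) that by (auto simp: L_def intro: span_base)
    show "y \<bullet> B (x - a) = 0" if "y \<in> E" "x \<in> T" for y x
      using BE'[OF that(2)] that(1) by (auto simp: E'_def orthogonal_def)
  qed fact+
qed

text \<open>Solved for \<open>v\<close>, the equation
  \<open>x + \<beta> x *\<^sub>R v = \<psi> y\<close> says that \<open>v\<close> is the value of a
  differentiable map \<open>G\<close> at the code of \<open>(y, x)\<close>. As the dimensions of
  \<open>E\<close> and \<open>T\<close> add up to at most that of the ambient space, codes exist
  there and \<open>G\<close> maps this space to itself. The excluded \<open>v\<close> are the
  critical values of \<open>G\<close> and its values on a hyperplane.\<close>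

lemma generic_chart_intersection:
  fixes E T V :: "'a::euclidean_space set" and \<psi> :: "'a \<Rightarrow> 'a" and \<beta> :: "'a \<Rightarrow> real"
  assumes E: "subspace E" and dim: "aff_dim T \<le> int DIM('a) - int (dim E)"
    and V: "open V" and \<psi>: "\<psi> differentiable_on V" and \<beta>: "\<And>x. \<beta> differentiable (at x)"
    and e: "e \<in> E" "e \<noteq> 0"
  obtains N where "negligible N"
    and "\<And>v x y. v \<notin> N \<Longrightarrow> x \<in> T \<Longrightarrow> y \<in> V \<inter> E \<Longrightarrow> \<beta> x > 0 \<Longrightarrow> x + \<beta> x *\<^sub>R v = \<psi> y \<Longrightarrow> y \<bullet> e \<noteq> 0"
    and "\<And>v x y. v \<notin> N \<Longrightarrow> x \<in> T \<Longrightarrow> y \<in> V \<inter> E \<Longrightarrow> \<beta> x > 0 \<Longrightarrow> x + \<beta> x *\<^sub>R v = \<psi> y \<Longrightarrow>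
      \<exists>\<delta>>0. \<forall>x'\<in>T. \<forall>y'\<in>V \<inter> E. \<beta> x' > 0 \<longrightarrow> dist x' x < \<delta> \<longrightarrow> dist y' y < \<delta> \<longrightarrow>
        x' + \<beta> x' *\<^sub>R v = \<psi> y' \<longrightarrow> y' = y"
proof (cases "T = {}")
  case True
  then show thesis
    using that[of "{}"] by auto
next
  case False
  then obtain a where a: "a \<in> T"
    by blast
  obtain \<pi> A B where lin: "linear \<pi>" "linear A" "linear B"
    and \<pi>: "\<And>y x. y \<in> E \<Longrightarrow> x \<in> T \<Longrightarrow> \<pi> (y + B (x - a)) = y"
    and A: "\<And>x. x \<in> T \<Longrightarrow> A (B (x - a)) = x - a"
    and orth: "\<And>y x. y \<in> E \<Longrightarrow> x \<in> T \<Longrightarrow> y \<bullet> B (x - a) = 0"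
    using linear_coordinates_complement[OF E dim a] by metis
  \<comment> \<open>If \<open>z\<close> encodes \<open>(y, x)\<close>, then
    \<open>z - \<pi> z\<close> is \<open>B (x - a)\<close>, so \<open>q\<close> returns
    \<open>x\<close> while \<open>\<pi>\<close> returns \<open>y\<close>.\<close>
  define q where "q = (\<lambda>z. a + A (z - \<pi> z))"
  define G where "G = (\<lambda>z. (1 / \<beta> (q z)) *\<^sub>R (\<psi> (\<pi> z) - q z))"
  define \<Omega> where "\<Omega> = {z. \<pi> z \<in> V \<and> \<beta> (q z) > 0}"
  define Z where "Z = (\<lambda>x y. y + B (x - a))"
  have \<pi>Z: "\<pi> (Z x y) = y" and qZ: "q (Z x y) = x" if "x \<in> T" "y \<in> V \<inter> E" for x y
    using that by (auto simp: Z_def q_def \<pi> A)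
  have GZ: "G (Z x y) = v" if "x \<in> T" "y \<in> V \<inter> E" "\<beta> x > 0" "x + \<beta> x *\<^sub>R v = \<psi> y" for v x y
  proof -
    have "\<psi> y - x = \<beta> x *\<^sub>R v"
      by (simp flip: that(4))
    then show ?thesis
      using that(3) by (simp add: G_def \<pi>Z[OF that(1,2)] qZ[OF that(1,2)])
  qed
  have \<Omega>Z: "Z x y \<in> \<Omega>" if "x \<in> T" "y \<in> V \<inter> E" "\<beta> x > 0" for x y
    using that by (auto simp: \<Omega>_def \<pi>Z qZ)
  have diff: "G differentiable (at z)" if z: "z \<in> \<Omega>" for z
  proof -
    have d\<pi>: "\<pi> differentiable (at z)"
      using lin(1) linear_imp_differentiable by blast
    have "(\<lambda>z. A (z - \<pi> z)) differentiable (at z)"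
      using lin(1,2) linear_compose_sub[OF linear_ident] linear_compose[of "\<lambda>z. z - \<pi> z" A]
      by (intro linear_imp_differentiable) (auto simp: o_def)
    then have dq: "q differentiable (at z)"
      unfolding q_def by (intro differentiable_add differentiable_const)
    have d\<beta>: "(\<lambda>z. \<beta> (q z)) differentiable (at z)"
      using differentiable_chain_at[OF dq \<beta>] by (simp add: o_def)
    have "\<psi> differentiable (at (\<pi> z))"
      using \<psi> z V by (simp add: \<Omega>_def differentiable_on_eq_differentiable_at)
    then have d\<psi>: "(\<lambda>z. \<psi> (\<pi> z)) differentiable (at z)"
      using differentiable_chain_at[OF d\<pi>] by (simp add: o_def)
    show ?thesis
      unfolding G_def using z
      by (intro differentiable_scaleR differentiable_divide differentiable_const differentiable_diff
            d\<beta> d\<psi> dq) (auto simp: \<Omega>_def)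
  qed
  obtain N where N: "negligible N"
    and iso: "\<And>z. z \<in> \<Omega> \<Longrightarrow> G z \<notin> N \<Longrightarrow> \<exists>\<delta>>0. \<forall>y. dist y z < \<delta> \<longrightarrow> G y = G z \<longrightarrow> y = z"
    using negligible_nonisolated_values[OF diff] by metis
  \<comment> \<open>Since \<open>e\<close> is orthogonal to every \<open>B (x - a)\<close>, all
    codes with \<open>y \<bullet> e = 0\<close> lie in one hyperplane. Hence \<open>N'\<close>
    catches every velocity that sends a point of \<open>T\<close> to the boundary, and it is null as
    a differentiable image of a null set.\<close>
  define N' where "N' = G ` {z \<in> \<Omega>. e \<bullet> z = 0}"
  have "negligible {z \<in> \<Omega>. e \<bullet> z = 0}"
    using negligible_hyperplane[of e 0] e(2) by (auto intro: negligible_subset)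
  then have N': "negligible N'"
    unfolding N'_def
    by (rule negligible_differentiable_image_negligible[OF order_refl])
       (auto intro!: differentiable_at_imp_differentiable_on diff)
  show thesis
  proof
    show "negligible (N \<union> N')"
      using N N' by simp
    fix v x y
    assume v: "v \<notin> N \<union> N'" and x: "x \<in> T" and y: "y \<in> V \<inter> E" and pos: "\<beta> x > 0"
      and eq: "x + \<beta> x *\<^sub>R v = \<psi> y"
    note G = GZ[OF x y pos eq] and \<Omega> = \<Omega>Z[OF x y pos]
    show "y \<bullet> e \<noteq> 0"
    proof
      assume "y \<bullet> e = 0"
      then have "e \<bullet> Z x y = 0"
        using orth[OF e(1) x] by (simp add: Z_def inner_add_right inner_commute)
      then show False
        using v G \<Omega> by (auto simp: N'_def)
    qed
    obtain \<delta> where \<delta>: "\<delta> > 0" "\<And>z. dist z (Z x y) < \<delta> \<Longrightarrow> G z = v \<Longrightarrow> z = Z x y"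
      using iso[OF \<Omega>] G v by auto
    \<comment> \<open>Continuity of \<open>B\<close> turns closeness of \<open>(y', x')\<close> to
      \<open>(y, x)\<close> into closeness of the codes: one half of \<open>\<delta>\<close> is for
      the part in \<open>E\<close>, the other for the part in the image of \<open>B\<close>.\<close>
    have "isCont B 0"
      using lin(3) linear_continuous_at linear_conv_bounded_linear by blast
    then obtain \<eta> where \<eta>: "\<eta> > 0" "\<And>w. norm w < \<eta> \<Longrightarrow> norm (B w) < \<delta> / 2"
      using \<delta>(1) linear_0[OF lin(3)] unfolding continuous_at_eps_delta dist_norm
      by (metis diff_zero half_gt_zero)
    have "y' = y" if "x' \<in> T" "y' \<in> V \<inter> E" "\<beta> x' > 0" "dist x' x < min \<eta> (\<delta> / 2)"
      "dist y' y < min \<eta> (\<delta> / 2)" "x' + \<beta> x' *\<^sub>R v = \<psi> y'" for x' y'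
    proof -
      have "B (x' - a) - B (x - a) = B (x' - x)"
        using linear_diff[OF lin(3), of "x' - a" "x - a"] by simp
      then have "Z x' y' - Z x y = (y' - y) + B (x' - x)"
        by (simp add: Z_def algebra_simps)
      then have "dist (Z x' y') (Z x y) \<le> norm (y' - y) + norm (B (x' - x))"
        by (simp add: dist_norm norm_triangle_ineq)
      also have "\<dots> < \<delta>"
        using that \<eta>(2)[of "x' - x"] by (simp add: dist_norm)
      finally have "Z x' y' = Z x y"
        using \<delta>(2) GZ that by blast
      then show ?thesis
        using \<pi>Z[OF x y] \<pi>Z[OF that(1,2)] by simp
    qed
    then show "\<exists>\<delta>>0. \<forall>x'\<in>T. \<forall>y'\<in>V \<inter> E. \<beta> x' > 0 \<longrightarrow> dist x' x < \<delta> \<longrightarrow> dist y' y < \<delta> \<longrightarrow>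
        x' + \<beta> x' *\<^sub>R v = \<psi> y' \<longrightarrow> y' = y"
      using \<delta>(1) \<eta>(1) by (intro exI[of _ "min \<eta> (\<delta> / 2)"]) auto
  qed
qed

text \<open>The chart condition of \<open>submanifold_with_boundary\<close> freed from its base
  point, so that one chart serves all points of \<open>U \<inter> M\<close>. Those sent to
  \<open>y \<bullet> e > 0\<close> are off the boundary.\<close>

definition boundary_chart ::
  "nat \<Rightarrow> 'a::euclidean_space set \<Rightarrow> 'a set \<Rightarrow> 'a set \<Rightarrow> ('a \<Rightarrow> 'a) \<Rightarrow> ('a \<Rightarrow> 'a) \<Rightarrow> 'a set \<Rightarrow> 'a \<Rightarrow> bool"
  where "boundary_chart k M U V \<phi> \<psi> E e \<longleftrightarrow>
    diffeo_between U V \<phi> \<psi> \<and> subspace E \<and> dim E = k \<and> e \<in> E \<and> e \<noteq> 0 \<and>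
    \<phi> ` (U \<inter> M) = V \<inter> {y \<in> E. y \<bullet> e \<ge> 0}"

text \<open>By compactness finitely many charts suffice. Each pair of such a chart and a member of
  \<open>\<T>\<close> excludes a null set of velocities, and finitely many null sets cannot fill a
  ball of radius \<open>\<delta>\<close>. Isolation is asserted inside each \<open>T\<close>
  separately.\<close>

lemma generic_manifold_intersection:
  fixes M :: "'a::euclidean_space set" and \<beta> :: "'a \<Rightarrow> real"
  assumes M: "compact M" "submanifold_with_boundary k M"
    and \<T>: "finite \<T>" "\<And>T. T \<in> \<T> \<Longrightarrow> aff_dim T \<le> int DIM('a) - int k"
    and \<beta>: "\<And>x. \<beta> differentiable (at x)" and "\<delta> > 0"
  obtains v where "norm v < \<delta>"
    and "\<And>x. x \<in> \<Union>\<T> \<Longrightarrow> \<beta> x > 0 \<Longrightarrow> x + \<beta> x *\<^sub>R v \<in> M \<Longrightarrow>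
      \<exists>U V \<phi> \<psi> E e. boundary_chart k M U V \<phi> \<psi> E e \<and> x + \<beta> x *\<^sub>R v \<in> U \<and> \<phi> (x + \<beta> x *\<^sub>R v) \<bullet> e > 0"
    and "\<And>T x. T \<in> \<T> \<Longrightarrow> x \<in> T \<Longrightarrow> \<beta> x > 0 \<Longrightarrow> x + \<beta> x *\<^sub>R v \<in> M \<Longrightarrow>
      \<exists>\<eta>>0. \<forall>x'\<in>T. dist x' x < \<eta> \<longrightarrow> \<beta> x' > 0 \<longrightarrow> x' + \<beta> x' *\<^sub>R v \<in> M \<longrightarrow>
        x' + \<beta> x' *\<^sub>R v = x + \<beta> x *\<^sub>R v"
proof -
  have "\<forall>p\<in>M. \<exists>U V \<phi> \<psi> E e. p \<in> U \<and> boundary_chart k M U V \<phi> \<psi> E e"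
    using M(2) unfolding submanifold_with_boundary_def boundary_chart_def by blast
  then obtain U V \<phi> \<psi> E e where pU: "\<And>p. p \<in> M \<Longrightarrow> p \<in> U p"
    and chart: "\<And>p. p \<in> M \<Longrightarrow> boundary_chart k M (U p) (V p) (\<phi> p) (\<psi> p) (E p) (e p)"
    by metis
  have opU: "open (U p)" and opV: "open (V p)" and hom: "homeomorphism (U p) (V p) (\<phi> p) (\<psi> p)"
    and smooth: "smooth_on (V p) (\<psi> p)"
    and E: "subspace (E p)" "dim (E p) = k" "e p \<in> E p" "e p \<noteq> 0"
    and \<phi>M: "\<phi> p ` (U p \<inter> M) = V p \<inter> {y \<in> E p. y \<bullet> e p \<ge> 0}" if "p \<in> M" for p
    using chart[OF that] by (auto simp: boundary_chart_def diffeo_between_def)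
  have \<psi>: "\<psi> p differentiable_on V p" if "p \<in> M" for p
    using smooth[OF that] unfolding smooth_on_def by (metis Cn_on.simps(2))
  \<comment> \<open>\<open>bad p T N\<close> says that the null set \<open>N\<close> contains every
    velocity for which \<open>T\<close> is not in general position to \<open>M\<close> in the chart
    at \<open>p\<close>.\<close>
  define bad where "bad = (\<lambda>p T N. negligible N \<and>
      (\<forall>v x y. v \<notin> N \<longrightarrow> x \<in> T \<longrightarrow> y \<in> V p \<inter> E p \<longrightarrow> \<beta> x > 0 \<longrightarrow> x + \<beta> x *\<^sub>R v = \<psi> p y \<longrightarrow> y \<bullet> e p \<noteq> 0) \<and>
      (\<forall>v x y. v \<notin> N \<longrightarrow> x \<in> T \<longrightarrow> y \<in> V p \<inter> E p \<longrightarrow> \<beta> x > 0 \<longrightarrow> x + \<beta> x *\<^sub>R v = \<psi> p y \<longrightarrow>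
        (\<exists>\<delta>>0. \<forall>x'\<in>T. \<forall>y'\<in>V p \<inter> E p. \<beta> x' > 0 \<longrightarrow> dist x' x < \<delta> \<longrightarrow> dist y' y < \<delta> \<longrightarrow>
          x' + \<beta> x' *\<^sub>R v = \<psi> p y' \<longrightarrow> y' = y)))"
  have "\<exists>N. bad p T N" if "p \<in> M" "T \<in> \<T>" for p T
  proof -
    have "aff_dim T \<le> int DIM('a) - int (dim (E p))"
      using \<T>(2)[OF that(2)] E(2)[OF that(1)] by simp
    then show ?thesis
      by (rule generic_chart_intersection[OF E(1)[OF that(1)] _ opV[OF that(1)] \<psi>[OF that(1)] \<beta>
            E(3,4)[OF that(1)]]) (unfold bad_def, rule exI, intro conjI allI impI)
  qed
  then obtain N where N: "\<And>p T. p \<in> M \<Longrightarrow> T \<in> \<T> \<Longrightarrow> bad p T (N p T)"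
    by metis
  obtain I where I: "I \<subseteq> M" "finite I" "M \<subseteq> (\<Union>p\<in>I. U p)"
    using compactE_image[OF M(1), of M U] opU pU by blast
  have "negligible (\<Union>p\<in>I. \<Union>T\<in>\<T>. N p T)"
    using I(1,2) \<T>(1) N by (intro negligible_Union finite_imageI) (auto simp: bad_def)
  moreover have "\<not> negligible (ball (0::'a) \<delta>)"
    using \<open>\<delta> > 0\<close> by (intro open_not_negligible) auto
  ultimately obtain v where v: "v \<in> ball 0 \<delta>" "v \<notin> (\<Union>p\<in>I. \<Union>T\<in>\<T>. N p T)"
    using negligible_subset by blast
  define f where "f = (\<lambda>x. x + \<beta> x *\<^sub>R v)"
  have contf: "isCont f x" for x
    unfolding f_def using \<beta> differentiable_imp_continuous_within by (intro continuous_intros) blast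
  have coords: "\<exists>p\<in>I. z \<in> U p \<and> z \<in> M" if "z \<in> M" for z
    using that I by blast
  have \<phi>z: "\<phi> p z \<in> V p \<inter> E p" "\<phi> p z \<bullet> e p \<ge> 0" "\<psi> p (\<phi> p z) = z" if "p \<in> M" "z \<in> U p" "z \<in> M" for p z
  proof -
    have "\<phi> p z \<in> \<phi> p ` (U p \<inter> M)"
      using that by blast
    then show "\<phi> p z \<in> V p \<inter> E p" "\<phi> p z \<bullet> e p \<ge> 0"
      unfolding \<phi>M[OF that(1)] by auto
    show "\<psi> p (\<phi> p z) = z"
      using homeomorphism_apply1[OF hom[OF that(1)] that(2)] .
  qed
  show thesis
  proof
    show "norm v < \<delta>"
      using v(1) by simp
  next
    fix x assume x: "x \<in> \<Union>\<T>" "\<beta> x > 0" "x + \<beta> x *\<^sub>R v \<in> M"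
    then obtain p T where p: "p \<in> I" "x + \<beta> x *\<^sub>R v \<in> U p" and T: "T \<in> \<T>" "x \<in> T"
      using coords by blast
    then have "p \<in> M"
      using I(1) by blast
    note z = \<phi>z[OF \<open>p \<in> M\<close> p(2) x(3)]
    have "v \<notin> N p T"
      using v(2) p(1) T(1) by blast
    then have "\<phi> p (x + \<beta> x *\<^sub>R v) \<bullet> e p \<noteq> 0"
      using N[OF \<open>p \<in> M\<close> T(1)] T(2) x(2) z(1,3) unfolding bad_def by metis
    then show "\<exists>U V \<phi> \<psi> E e. boundary_chart k M U V \<phi> \<psi> E e \<and> x + \<beta> x *\<^sub>R v \<in> U \<and>
        \<phi> (x + \<beta> x *\<^sub>R v) \<bullet> e > 0"
      using chart[OF \<open>p \<in> M\<close>] p(2) z(2) by (metis less_eq_real_def)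
  next
    fix T x assume T: "T \<in> \<T>" "x \<in> T" and x: "\<beta> x > 0" "x + \<beta> x *\<^sub>R v \<in> M"
    then obtain p where p: "p \<in> I" "x + \<beta> x *\<^sub>R v \<in> U p"
      using coords by blast
    then have "p \<in> M"
      using I(1) by blast
    note z = \<phi>z[OF \<open>p \<in> M\<close> p(2) x(2)]
    have "v \<notin> N p T"
      using v(2) p(1) T(1) by blast
    then have "\<exists>\<delta>>0. \<forall>x'\<in>T. \<forall>y'\<in>V p \<inter> E p. \<beta> x' > 0 \<longrightarrow> dist x' x < \<delta> \<longrightarrow>
        dist y' (\<phi> p (f x)) < \<delta> \<longrightarrow> x' + \<beta> x' *\<^sub>R v = \<psi> p y' \<longrightarrow> y' = \<phi> p (f x)"
      using N[OF \<open>p \<in> M\<close> T(1)] T(2) x(1) z(1,3) unfolding bad_def f_def by presburger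
    then obtain \<delta> where \<delta>: "\<delta> > 0"
        "\<And>x' y'. x' \<in> T \<Longrightarrow> y' \<in> V p \<inter> E p \<Longrightarrow> \<beta> x' > 0 \<Longrightarrow> dist x' x < \<delta> \<Longrightarrow>
          dist y' (\<phi> p (f x)) < \<delta> \<Longrightarrow> x' + \<beta> x' *\<^sub>R v = \<psi> p y' \<Longrightarrow> y' = \<phi> p (f x)"
      by metis
    have fxU: "f x \<in> U p"
      using p(2) by (simp add: f_def)
    \<comment> \<open>The isolation in \<open>\<delta>(2)\<close> asks for nearness in
      \<open>T\<close> and in chart coordinates. Continuity of \<open>\<phi> p\<close> along
      \<open>f\<close> derives the second from the first.\<close>
    have "isCont (\<phi> p) (f x)"
      using homeomorphism_cont1[OF hom[OF \<open>p \<in> M\<close>]] continuous_on_eq_continuous_at opU[OF \<open>p \<in> M\<close>] fxU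
      by blast
    then have "isCont (\<lambda>x. \<phi> p (f x)) x"
      using isCont_o2[OF contf] by blast
    then have "\<forall>\<^sub>F x' in at x. dist (\<phi> p (f x')) (\<phi> p (f x)) < \<delta>"
      using \<delta>(1) unfolding isCont_def by (rule tendstoD)
    moreover have "\<forall>\<^sub>F x' in at x. f x' \<in> U p"
      using contf[of x] opU[OF \<open>p \<in> M\<close>] fxU unfolding isCont_def by (rule topological_tendstoD)
    ultimately have "\<forall>\<^sub>F x' in at x. f x' \<in> U p \<and> dist (\<phi> p (f x')) (\<phi> p (f x)) < \<delta>"
      by eventually_elim simp
    then obtain \<eta> where \<eta>: "\<eta> > 0" "\<And>x'. x' \<noteq> x \<Longrightarrow> dist x' x < \<eta> \<Longrightarrow>
        f x' \<in> U p \<and> dist (\<phi> p (f x')) (\<phi> p (f x)) < \<delta>"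
      unfolding eventually_at by blast
    have "f x' = f x" if "x' \<in> T" "dist x' x < min \<eta> \<delta>" "\<beta> x' > 0" "f x' \<in> M" for x'
    proof (cases "x' = x")
      case False
      then have 1: "f x' \<in> U p" "dist (\<phi> p (f x')) (\<phi> p (f x)) < \<delta>"
        using \<eta>(2) that by auto
      note z' = \<phi>z[OF \<open>p \<in> M\<close> 1(1) that(4)]
      have "\<phi> p (f x') = \<phi> p (f x)"
      proof (rule \<delta>(2)[of x'])
        show "x' + \<beta> x' *\<^sub>R v = \<psi> p (\<phi> p (f x'))"
          using z'(3) by (simp add: f_def)
      qed (use that 1(2) z'(1) in auto)
      then show ?thesis
        using z'(3) z(3) unfolding f_def by metis
    qed simp
    then have "\<forall>x'\<in>T. dist x' x < min \<eta> \<delta> \<longrightarrow> \<beta> x' > 0 \<longrightarrow> f x' \<in> M \<longrightarrow> f x' = f x"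
      by blast
    moreover have "min \<eta> \<delta> > 0"
      using \<eta>(1) \<delta>(1) by simp
    ultimately show "\<exists>\<eta>>0. \<forall>x'\<in>T. dist x' x < \<eta> \<longrightarrow> \<beta> x' > 0 \<longrightarrow> x' + \<beta> x' *\<^sub>R v \<in> M \<longrightarrow>
        x' + \<beta> x' *\<^sub>R v = x + \<beta> x *\<^sub>R v"
      unfolding f_def by blast
  qed
qed

section \<open>Isotopies supported in small sets\<close>

text \<open>A preimage of \<open>y\<close> is a fixed point of
  \<open>x \<mapsto> y - (t * \<beta> x) *\<^sub>R v\<close>, which contracts by the factor
  \<open>K * norm v < 1\<close>; Banach's theorem gives exactly one.\<close>

lemma cutoff_translation_bij:
  fixes \<beta> :: "'a::banach \<Rightarrow> real"
  assumes lip: "\<And>x y. \<bar>\<beta> x - \<beta> y\<bar> \<le> K * dist x y" and K: "0 \<le> K" "K * norm v < 1"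
    and t: "t \<in> {0..1}"
  shows "bij (\<lambda>x. x + (t * \<beta> x) *\<^sub>R v)"
proof -
  have "\<exists>!x. x + (t * \<beta> x) *\<^sub>R v = y" for y
  proof -
    have "dist (y - (t * \<beta> x) *\<^sub>R v) (y - (t * \<beta> x') *\<^sub>R v) \<le> (K * norm v) * dist x x'" for x x'
    proof -
      have "dist (y - (t * \<beta> x) *\<^sub>R v) (y - (t * \<beta> x') *\<^sub>R v) = norm ((t * (\<beta> x' - \<beta> x)) *\<^sub>R v)"
        by (simp add: dist_norm algebra_simps)
      also have "\<dots> = t * (\<bar>\<beta> x' - \<beta> x\<bar> * norm v)"
        using t by (simp add: abs_mult)
      also have "\<dots> \<le> 1 * ((K * dist x' x) * norm v)"
        using t K(1) by (intro mult_mono lip) auto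
      finally show ?thesis
        by (simp add: dist_commute mult_ac)
    qed
    then have "\<exists>!x. y - (t * \<beta> x) *\<^sub>R v = x"
      using K by (intro banach_fix_type[of "K * norm v"]) auto
    moreover have "y - (t * \<beta> x) *\<^sub>R v = x \<longleftrightarrow> x + (t * \<beta> x) *\<^sub>R v = y" for x
      by (auto simp: algebra_simps)
    ultimately show ?thesis
      by simp
  qed
  then show ?thesis
    unfolding bij_iff by blast
qed

text \<open>If \<open>\<beta>\<close> vanishes at the image of \<open>x\<close>, the map fixes that
  image; then \<open>x\<close> and its image have the same value, and injectivity identifies
  them.\<close>

lemma cutoff_translation_support:
  fixes \<beta> :: "'a::real_vector \<Rightarrow> real"
  assumes "bij (\<lambda>x. x + (t * \<beta> x) *\<^sub>R v)"
  shows "\<beta> (x + (t * \<beta> x) *\<^sub>R v) = 0 \<longleftrightarrow> \<beta> x = 0"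
proof
  assume "\<beta> (x + (t * \<beta> x) *\<^sub>R v) = 0"
  then have "(\<lambda>x. x + (t * \<beta> x) *\<^sub>R v) (x + (t * \<beta> x) *\<^sub>R v) = (\<lambda>x. x + (t * \<beta> x) *\<^sub>R v) x"
    by simp
  then have "x + (t * \<beta> x) *\<^sub>R v = x"
    by (rule injD[OF bij_is_inj[OF assms]])
  then show "\<beta> x = 0"
    using \<open>\<beta> (x + (t * \<beta> x) *\<^sub>R v) = 0\<close> by (simp only:)
qed simp

section \<open>Differentiable cutoff functions with a Lipschitz bound\<close>

text \<open>Truncating the distance to \<open>m x = min (dist x c) s\<close> makes the bump
  \<open>(s\<^sup>2 - (m x)\<^sup>2)\<^sup>2\<close>. The function \<open>m\<close> is 1-Lipschitz,
  and the difference of two values factors as \<open>m y - m x\<close> times a term of size at most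
  \<open>(2 * s) * (2 * s\<^sup>2)\<close>.\<close>

lemma bump_Lipschitz:
  fixes c :: "'a::real_normed_vector"
  assumes "s > 0"
  defines "\<beta> \<equiv> \<lambda>x. (max 0 (s\<^sup>2 - (dist x c)\<^sup>2))\<^sup>2"
  shows "\<bar>\<beta> x - \<beta> y\<bar> \<le> (4 * s ^ 3) * dist x y"
proof -
  define m where "m = (\<lambda>x. min (dist x c) s)"
  have m: "0 \<le> m x" "m x \<le> s" for x
    using assms(1) by (auto simp: m_def)
  have m2: "(m x)\<^sup>2 \<le> s\<^sup>2" for x
    using m by (simp add: power_mono)
  have \<beta>: "\<beta> x = (s\<^sup>2 - (m x)\<^sup>2)\<^sup>2" for x
  proof (cases "dist x c \<le> s")
    case True
    then have "(dist x c)\<^sup>2 \<le> s\<^sup>2"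
      by (simp add: power_mono)
    then show ?thesis
      using True by (simp add: \<beta>_def m_def)
  next
    case False
    then have "s\<^sup>2 \<le> (dist x c)\<^sup>2"
      using assms(1) by (intro power_mono) auto
    then show ?thesis
      using False by (simp add: \<beta>_def m_def)
  qed
  have "\<bar>m y - m x\<bar> \<le> dist x y"
    using dist_triangle[of x c y] dist_triangle[of y c x] by (auto simp: m_def dist_commute min_def)
  moreover have "\<beta> x - \<beta> y = (m y - m x) * ((m y + m x) * ((s\<^sup>2 - (m x)\<^sup>2) + (s\<^sup>2 - (m y)\<^sup>2)))"
    unfolding \<beta> by (simp add: power2_eq_square algebra_simps)
  moreover have "\<bar>(m y + m x) * ((s\<^sup>2 - (m x)\<^sup>2) + (s\<^sup>2 - (m y)\<^sup>2))\<bar> \<le> (2 * s) * (2 * s\<^sup>2)"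
    unfolding abs_mult
  proof (rule mult_mono)
    show "\<bar>m y + m x\<bar> \<le> 2 * s"
      using m[of x] m[of y] by simp
    have "0 \<le> (m x)\<^sup>2" "0 \<le> (m y)\<^sup>2"
      by auto
    then show "\<bar>(s\<^sup>2 - (m x)\<^sup>2) + (s\<^sup>2 - (m y)\<^sup>2)\<bar> \<le> 2 * s\<^sup>2"
      using m2[of x] m2[of y] by linarith
  qed (use assms(1) in auto)
  ultimately have "\<bar>\<beta> x - \<beta> y\<bar> \<le> dist x y * ((2 * s) * (2 * s\<^sup>2))"
    unfolding \<open>\<beta> x - \<beta> y = _\<close> by (subst abs_mult, intro mult_mono) simp_all
  then show ?thesis
    by (simp add: power2_eq_square power3_eq_cube mult_ac)
qed

text \<open>Squaring removes the kink of \<open>max 0 u\<close>, leaving the derivative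
  \<open>2 * max 0 u\<close>, and the squared distance is an inner product, hence differentiable at
  \<open>c\<close> too.\<close>

lemma bump_differentiable:
  fixes c :: "'a::euclidean_space"
  shows "(\<lambda>x. (max 0 (s\<^sup>2 - (dist x c)\<^sup>2))\<^sup>2) differentiable (at x)"
proof -
  have "((\<lambda>u. (max 0 u)\<^sup>2) has_real_derivative 2 * max 0 u) (at u)" for u :: real
  proof -
    have sq: "((\<lambda>u::real. u\<^sup>2) has_real_derivative 2 * u) (at u)" for u
      by (auto intro!: derivative_eq_intros)
    consider "u > 0" | "u < 0" | "u = 0"
      by linarith
    then show ?thesis
    proof cases
      case 1
      have "((\<lambda>u. (max 0 u)\<^sup>2) has_real_derivative 2 * u) (at u)"
        by (rule has_field_derivative_transform_within_open[OF sq, of "{0<..}"]) (use 1 in auto)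
      then show ?thesis
        using 1 by simp
    next
      case 2
      have "((\<lambda>u. (max 0 u)\<^sup>2) has_real_derivative 0) (at u)"
        by (rule has_field_derivative_transform_within_open[OF DERIV_const, of "{..<0}"]) (use 2 in auto)
      then show ?thesis
        using 2 by simp
    next
      case 3
      have "((\<lambda>h. (max 0 h)\<^sup>2 / h) \<longlongrightarrow> 0) (at (0::real))"
      proof (rule Lim_null_comparison)
        show "\<forall>\<^sub>F h in at 0. norm ((max 0 h)\<^sup>2 / h) \<le> \<bar>h::real\<bar>"
          by (rule always_eventually) (auto simp: max_def power2_eq_square)
        show "((\<lambda>h. \<bar>h::real\<bar>) \<longlongrightarrow> 0) (at 0)"
          using tendsto_rabs_zero tendsto_ident_at by blast
      qed
      then show ?thesis
        using 3 by (simp add: DERIV_def)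
    qed
  qed
  then have 1: "(\<lambda>u::real. (max 0 u)\<^sup>2) differentiable (at u)" for u
    using real_differentiable_def by blast
  have "(\<lambda>x. (dist x c)\<^sup>2) = (\<lambda>x. (x - c) \<bullet> (x - c))"
    by (simp add: dist_norm power2_norm_eq_inner)
  moreover have "(\<lambda>x. (x - c) \<bullet> (x - c)) differentiable (at x)"
    by (intro differentiable_inner differentiable_diff differentiable_ident differentiable_const)
  ultimately have "(\<lambda>x. s\<^sup>2 - (dist x c)\<^sup>2) differentiable (at x)"
    by (intro differentiable_diff differentiable_const) simp
  from differentiable_chain_at[OF this 1] show ?thesis
    by (simp add: o_def)
qed

text \<open>A finite sum of bumps of radius \<open>\<epsilon>\<close> with centres in
  \<open>A\<close>. Their balls cover the compact closure of \<open>A\<close>, which gives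
  positivity on \<open>A\<close>; centres in \<open>A\<close> give vanishing off the neighbourhood.
  Differentiability serves the Sard argument, the Lipschitz bound serves bijectivity.\<close>

lemma differentiable_Lipschitz_cutoff:
  fixes A :: "'a::euclidean_space set"
  assumes "bounded A" and "\<epsilon> > 0"
  obtains \<beta> :: "'a \<Rightarrow> real" and K B where "\<And>x. \<beta> differentiable (at x)" and "K \<ge> 0"
    and "\<And>x y. \<bar>\<beta> x - \<beta> y\<bar> \<le> K * dist x y" and "\<And>x. \<beta> x \<ge> 0" and "\<And>x. \<beta> x \<le> B"
    and "\<And>x. x \<in> A \<Longrightarrow> \<beta> x > 0" and "\<And>x. x \<notin> nbhd A \<epsilon> \<Longrightarrow> \<beta> x = 0"
proof -
  have "compact (closure A)"
    using assms(1) compact_closure by blast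
  moreover have "closure A \<subseteq> (\<Union>a\<in>A. ball a \<epsilon>)"
    using assms(2) by (force simp: closure_approachable)
  ultimately obtain I where I: "I \<subseteq> A" "finite I" "closure A \<subseteq> (\<Union>a\<in>I. ball a \<epsilon>)"
    using compactE_image[of "closure A" A "\<lambda>a. ball a \<epsilon>"] by auto
  define b where "b = (\<lambda>c x :: 'a. (max 0 (\<epsilon>\<^sup>2 - (dist x c)\<^sup>2))\<^sup>2)"
  have sq: "(dist x c)\<^sup>2 < \<epsilon>\<^sup>2 \<longleftrightarrow> dist x c < \<epsilon>" for x c :: 'a
    using assms(2) by (metis abs_of_nonneg less_eq_real_def power_less_imp_less_base power_strict_mono zero_le_dist zero_less_numeral)
  have b_pos: "b c x > 0 \<longleftrightarrow> dist x c < \<epsilon>" and b_0: "b c x = 0 \<longleftrightarrow> \<not> dist x c < \<epsilon>" for c x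
    using sq[of x c] by (auto simp: b_def max_def)
  have b_nonneg: "b c x \<ge> 0" for c x
    by (simp add: b_def)
  have b_le: "b c x \<le> (\<epsilon>\<^sup>2)\<^sup>2" for c x
    unfolding b_def by (intro power_mono) auto
  show thesis
  proof
    show "(\<lambda>x. \<Sum>c\<in>I. b c x) differentiable (at x)" for x
      using I(2) bump_differentiable by (intro differentiable_sum) (auto simp: b_def)
    show "0 \<le> of_nat (card I) * (4 * \<epsilon> ^ 3)"
      using assms(2) by simp
    show "\<bar>(\<Sum>c\<in>I. b c x) - (\<Sum>c\<in>I. b c y)\<bar> \<le> of_nat (card I) * (4 * \<epsilon> ^ 3) * dist x y" for x y
    proof -
      have "\<bar>(\<Sum>c\<in>I. b c x) - (\<Sum>c\<in>I. b c y)\<bar> \<le> (\<Sum>c\<in>I. \<bar>b c x - b c y\<bar>)"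
        by (simp add: sum_abs flip: sum_subtractf)
      also have "\<dots> \<le> (\<Sum>c\<in>I. (4 * \<epsilon> ^ 3) * dist x y)"
        unfolding b_def by (intro sum_mono bump_Lipschitz[OF assms(2)])
      finally show ?thesis
        by (simp add: mult_ac)
    qed
    show "0 \<le> (\<Sum>c\<in>I. b c x)" for x
      using b_nonneg by (simp add: sum_nonneg)
    show "(\<Sum>c\<in>I. b c x) \<le> of_nat (card I) * (\<epsilon>\<^sup>2)\<^sup>2" for x
      using b_le by (metis sum_bounded_above)
    show "0 < (\<Sum>c\<in>I. b c x)" if "x \<in> A" for x
    proof -
      have "x \<in> closure A"
        using that closure_subset by blast
      then obtain c where "c \<in> I" "dist x c < \<epsilon>"
        using I(3) by (auto simp: dist_commute)
      then show ?thesis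
        using I(2) b_pos b_nonneg by (intro sum_pos2[of I c]) auto
    qed
    show "(\<Sum>c\<in>I. b c x) = 0" if "x \<notin> nbhd A \<epsilon>" for x
    proof (intro sum.neutral ballI)
      fix c assume "c \<in> I"
      then have "\<not> dist x c < \<epsilon>"
        using that I(1) by (auto simp: nbhd_def)
      then show "b c x = 0"
        using b_0 by blast
    qed
  qed
qed

section \<open>Moving one point of the manifold out of the subset\<close>

lemma cone_Lipschitz:
  fixes y0 :: "'a::metric_space"
  assumes "s > 0"
  shows "\<bar>max 0 (1 - dist x y0 / s) - max 0 (1 - dist y y0 / s)\<bar> \<le> (1 / s) * dist x y"
proof -
  have "dist x y0 / s \<le> (dist x y + dist y y0) / s" "dist y y0 / s \<le> (dist x y + dist x y0) / s"
    using dist_triangle[of x y0 y] dist_triangle[of y y0 x] assms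
    by (auto intro!: divide_right_mono simp: dist_commute)
  then show ?thesis
    by (auto simp: max_def abs_if add_divide_distrib)
qed

text \<open>Because \<open>\<phi> c \<bullet> e > 0\<close>, the set \<open>M\<close> looks like a
  flat piece of \<open>E\<close> near \<open>c\<close>. Some \<open>m\<close> of \<open>M\<close>
  close to \<open>c\<close> avoids \<open>S\<close>; a damped translation along \<open>E\<close>
  takes \<open>\<phi> c\<close> to \<open>\<phi> m\<close> and respects \<open>E\<close>, so its
  pullback respects \<open>M\<close>.\<close>

lemma chart_point_push:
  fixes M S :: "'a::euclidean_space set" and \<phi> \<psi> :: "'a \<Rightarrow> 'a"
  assumes hom: "homeomorphism U V \<phi> \<psi>" and U: "open U" and V: "open V" and E: "subspace E"
    and M: "\<phi> ` (U \<inter> M) = V \<inter> {y \<in> E. y \<bullet> e \<ge> 0}"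
    and c: "c \<in> U" "c \<in> M" "\<phi> c \<bullet> e > 0" and r: "r > 0"
    and S: "\<And>T. openin (top_of_set M) T \<Longrightarrow> T \<noteq> {} \<Longrightarrow> \<not> T \<subseteq> S"
  obtains u :: "'a \<Rightarrow> real \<Rightarrow> 'a" where "continuous_on (UNIV \<times> {0..1}) (\<lambda>(x,t). u x t)"
    and "\<And>t. t \<in> {0..1} \<Longrightarrow> bij (\<lambda>x. u x t)" and "\<And>x. u x 0 = x"
    and "\<And>x t. x \<notin> ball c r \<Longrightarrow> u x t = x"
    and "\<And>x t. t \<in> {0..1} \<Longrightarrow> u x t \<in> M \<longleftrightarrow> x \<in> M" and "u c 1 \<notin> S"
proof -
  have \<phi>\<psi>: "\<And>y. y \<in> V \<Longrightarrow> \<phi> (\<psi> y) = y" "\<And>y. y \<in> V \<Longrightarrow> \<psi> y \<in> U"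
    and \<psi>\<phi>: "\<And>x. x \<in> U \<Longrightarrow> \<psi> (\<phi> x) = x" "\<And>x. x \<in> U \<Longrightarrow> \<phi> x \<in> V"
    and cont: "continuous_on U \<phi>" "continuous_on V \<psi>"
    using hom by (auto simp: homeomorphism_def)
  have memM: "x \<in> M \<longleftrightarrow> \<phi> x \<in> E \<and> \<phi> x \<bullet> e \<ge> 0" if "x \<in> U" for x
  proof
    assume "x \<in> M"
    then have "\<phi> x \<in> \<phi> ` (U \<inter> M)"
      using that by blast
    then show "\<phi> x \<in> E \<and> \<phi> x \<bullet> e \<ge> 0"
      using M by blast
  next
    assume "\<phi> x \<in> E \<and> \<phi> x \<bullet> e \<ge> 0"
    then have "\<phi> x \<in> \<phi> ` (U \<inter> M)"
      using M \<psi>\<phi>(2) that by blast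
    then show "x \<in> M"
      using \<psi>\<phi>(1) that by (metis Int_iff imageE)
  qed
  define y0 where "y0 = \<phi> c"
  \<comment> \<open>The ball for the translation has to lie in \<open>V\<close>, over
    \<open>ball c r\<close>, and strictly inside the half-space.\<close>
  define D where "D = (V \<inter> \<psi> -` ball c r) \<inter> {y. y \<bullet> e > 0}"
  have "open D"
    unfolding D_def using continuous_open_preimage[OF cont(2) V open_ball]
    by (rule open_Int) (intro open_Collect_less continuous_intros)
  moreover have "y0 \<in> D"
    using c r \<psi>\<phi> by (simp add: D_def y0_def)
  ultimately obtain s where s: "s > 0" "cball y0 s \<subseteq> D"
    using open_contains_cball by metis
  then have cbV: "cball y0 s \<subseteq> V"
    by (auto simp: D_def)
  define U' where "U' = \<psi> ` ball y0 s"
  have U'_eq: "U' = U \<inter> \<phi> -` ball y0 s"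
  proof
    show "U' \<subseteq> U \<inter> \<phi> -` ball y0 s"
      using cbV \<phi>\<psi> ball_subset_cball unfolding U'_def by blast
    show "U \<inter> \<phi> -` ball y0 s \<subseteq> U'"
      using \<psi>\<phi> unfolding U'_def by (auto simp: image_iff) (metis mem_ball)
  qed
  have "open U'"
    unfolding U'_eq using continuous_open_preimage[OF cont(1) U open_ball] .
  have U'_sub: "U' \<subseteq> ball c r"
    using s(2) ball_subset_cball unfolding U'_def D_def by blast
  have "c \<in> U'"
    unfolding U'_eq using c s(1) by (simp add: y0_def)
  have "openin (top_of_set M) (M \<inter> U')" "M \<inter> U' \<noteq> {}"
    using \<open>open U'\<close> \<open>c \<in> U'\<close> c by (auto simp: openin_open_Int)
  then obtain m where m: "m \<in> M" "m \<in> U'" "m \<notin> S"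
    using S by blast
  define w where "w = \<phi> m - y0"
  have mU: "m \<in> U" and \<phi>m: "\<phi> m \<in> ball y0 s"
    using m(2) U'_eq by auto
  have wE: "w \<in> E"
    using memM[OF mU] memM[OF c(1)] m(1) c(2) E unfolding w_def y0_def by (simp add: subspace_diff)
  have ws: "norm w < s"
    using \<phi>m by (simp add: w_def dist_norm norm_minus_commute)
  \<comment> \<open>A tent of height 1 at \<open>y0\<close> and slope \<open>1 / s\<close>: at time
    1 it carries \<open>y0\<close> exactly to \<open>y0 + w = \<phi> m\<close>, and
    \<open>norm w < s\<close> makes the contraction factor less than 1.\<close>
  define b where "b = (\<lambda>y. max 0 (1 - dist y y0 / s))"
  have b_0: "b y = 0 \<longleftrightarrow> y \<notin> ball y0 s" for y
    using s(1) by (auto simp: b_def max_def field_simps dist_commute)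
  define \<tau> where "\<tau> = (\<lambda>y t. y + (t * b y) *\<^sub>R w)"
  have bij\<tau>: "bij (\<lambda>y. \<tau> y t)" if "t \<in> {0..1}" for t
    unfolding \<tau>_def
  proof (rule cutoff_translation_bij[of b "1 / s" w t])
    show "\<bar>b x - b y\<bar> \<le> 1 / s * dist x y" for x y
      unfolding b_def by (rule cone_Lipschitz[OF s(1)])
  qed (use s(1) ws that in \<open>auto simp: field_simps\<close>)
  have \<tau>_ball: "\<tau> y t \<in> ball y0 s \<longleftrightarrow> y \<in> ball y0 s" if "t \<in> {0..1}" for y t
    using cutoff_translation_support[OF bij\<tau>[OF that, unfolded \<tau>_def], of y] b_0
    unfolding \<tau>_def by metis
  have \<tau>_out: "\<tau> y t = y" if "y \<notin> ball y0 s" for y t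
    using b_0[of y] that by (simp add: \<tau>_def)
  have \<tau>_V: "\<tau> y t \<in> V" if "t \<in> {0..1}" "y \<in> V" for y t
    using \<tau>_ball[OF that(1), of y] \<tau>_out[of y t] that(2) cbV
    by (metis ball_subset_cball subsetD)
  have \<tau>_E: "\<tau> y t \<in> E \<longleftrightarrow> y \<in> E" for y t
    using subspace_add[OF E] subspace_diff[OF E] subspace_scale[OF E wE] unfolding \<tau>_def
    by (metis add_diff_cancel)
  define u where "u = (\<lambda>x t. if x \<in> U' then \<psi> (\<tau> (\<phi> x) t) else x)"
  have u_U: "u x t = \<psi> (\<tau> (\<phi> x) t)" if "x \<in> U" for x t
    using that \<tau>_out[of "\<phi> x" t] \<psi>\<phi>(1) unfolding u_def U'_eq by auto
  have \<phi>u: "\<phi> (u x t) = \<tau> (\<phi> x) t" and uU: "u x t \<in> U" if "x \<in> U" "t \<in> {0..1}" for x t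
    using \<phi>\<psi> \<tau>_V[OF that(2)] \<psi>\<phi>(2)[OF that(1)] by (auto simp: u_U[OF that(1)])
  have uU': "u x t \<in> U' \<longleftrightarrow> x \<in> U'" if t: "t \<in> {0..1}" for x t
  proof (cases "x \<in> U")
    case True
    then show ?thesis
      using \<phi>u[OF True t] uU[OF True t] \<tau>_ball[OF t] unfolding U'_eq by auto
  next
    case False
    then show ?thesis
      by (simp add: u_def U'_eq)
  qed
  show thesis
  proof
    have clU': "closed (\<psi> ` cball y0 s)"
      using compact_continuous_image[OF continuous_on_subset[OF cont(2) cbV] compact_cball]
      by (rule compact_imp_closed)
    have "continuous_on (U \<times> {0..1}) (\<lambda>(x,t). u x t)"
    proof -
      have "continuous_on (U \<times> {0..1::real}) (\<lambda>p. \<tau> (\<phi> (fst p)) (snd p))"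
        unfolding \<tau>_def b_def
        by (intro continuous_intros continuous_on_compose2[OF cont(1) continuous_on_fst]) (use s in auto)
      then have "continuous_on (U \<times> {0..1::real}) (\<lambda>p. \<psi> (\<tau> (\<phi> (fst p)) (snd p)))"
        by (rule continuous_on_compose2[OF cont(2)]) (auto intro!: \<tau>_V \<psi>\<phi>)
      then show ?thesis
        by (rule continuous_on_eq) (auto simp: u_U)
    qed
    moreover have "continuous_on ((- \<psi> ` cball y0 s) \<times> {0..1}) (\<lambda>(x,t::real). u x t)"
    proof (rule continuous_on_eq)
      show "continuous_on ((- \<psi> ` cball y0 s) \<times> {0..1::real}) fst"
        by (intro continuous_intros)
      show "fst p = (case p of (x,t) \<Rightarrow> u x t)" if "p \<in> (- \<psi> ` cball y0 s) \<times> {0..1::real}" for p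
        using that by (auto simp: u_def U'_def)
    qed
    moreover have "openin (top_of_set (UNIV \<times> {0..1})) (U \<times> {0..1::real})"
      by (intro openin_Times) (auto simp: U)
    moreover have "openin (top_of_set (UNIV \<times> {0..1})) ((- \<psi> ` cball y0 s) \<times> {0..1::real})"
      by (intro openin_Times) (use clU' in auto)
    moreover have "UNIV \<times> {0..1::real} = U \<times> {0..1} \<union> (- \<psi> ` cball y0 s) \<times> {0..1}"
      using cbV \<phi>\<psi>(2) by blast
    ultimately show "continuous_on (UNIV \<times> {0..1}) (\<lambda>(x,t). u x t)"
      using continuous_on_Un_local_open by metis
    show "bij (\<lambda>x. u x t)" if t: "t \<in> {0..1}" for t
    proof (rule bijI')
      show "(u x t = u x' t) = (x = x')" for x x'
      proof
        assume eq: "u x t = u x' t"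
        show "x = x'"
        proof (cases "x \<in> U'")
          case True
          then have "x' \<in> U'"
            using uU'[OF t] eq by metis
          then have "x \<in> U" "x' \<in> U"
            using True U'_eq by auto
          then have "\<tau> (\<phi> x) t = \<tau> (\<phi> x') t"
            using \<phi>u t eq by metis
          then have "\<phi> x = \<phi> x'"
            using bij\<tau>[OF t] by (metis bij_is_inj injD)
          then show ?thesis
            using \<psi>\<phi>(1) \<open>x \<in> U\<close> \<open>x' \<in> U\<close> by metis
        next
          case False
          then have "x' \<notin> U'"
            using uU'[OF t] eq by metis
          then show ?thesis
            using eq False by (simp add: u_def)
        qed
      qed simp
      show "\<exists>x. z = u x t" for z
      proof (cases "z \<in> U'")
        case True
        then have z: "z \<in> U" "\<phi> z \<in> ball y0 s"
          using U'_eq by auto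
        obtain y where y: "\<tau> y t = \<phi> z"
          using bij\<tau>[OF t] by (metis bij_pointE)
        then have "y \<in> ball y0 s"
          using \<tau>_ball[OF t] z(2) by metis
        then have yV: "y \<in> V"
          using cbV by auto
        then have "u (\<psi> y) t = z"
          using u_U[OF \<phi>\<psi>(2)[OF yV]] \<phi>\<psi>(1)[OF yV] y \<psi>\<phi>(1)[OF z(1)] by simp
        then show ?thesis
          by metis
      next
        case False
        then show ?thesis
          by (metis u_def)
      qed
    qed
    show "u x 0 = x" for x
      using \<psi>\<phi>(1) U'_eq by (auto simp: u_def \<tau>_def)
    show "u x t = x" if "x \<notin> ball c r" for x t
      using that U'_sub by (auto simp: u_def)
    show "u x t \<in> M \<longleftrightarrow> x \<in> M" if t: "t \<in> {0..1}" for x t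
    proof (cases "x \<in> U'")
      case True
      then have x: "x \<in> U" "\<phi> x \<in> ball y0 s"
        using U'_eq by auto
      \<comment> \<open>On the ball the half-space inequality is automatic before and after the
        move, so membership in \<open>M\<close> depends on \<open>E\<close> alone.\<close>
      have pos: "y \<bullet> e > 0" if "y \<in> ball y0 s" for y
        using subsetD[OF s(2) subsetD[OF ball_subset_cball that]] by (simp add: D_def)
      have "\<tau> (\<phi> x) t \<in> ball y0 s"
        using \<tau>_ball[OF t] x(2) by blast
      then show ?thesis
        using memM[OF x(1)] memM[OF uU[OF x(1) t]] \<phi>u[OF x(1) t] \<tau>_E pos x(2) less_imp_le by metis
    qed (simp add: u_def)
    have "b y0 = 1"
      by (simp add: b_def)
    then show "u c 1 \<notin> S"
      using u_U[OF c(1), of 1] m(3) \<psi>\<phi>(1)[OF mU] by (simp add: \<tau>_def w_def flip: y0_def)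
  qed
qed

section \<open>Gluing isotopies on disjoint balls\<close>

lemma finite_bounded_separated:
  fixes C :: "'a::heine_borel set"
  assumes "bounded C" and "\<eta> > 0" and sep: "\<And>c c'. c \<in> C \<Longrightarrow> c' \<in> C \<Longrightarrow> c \<noteq> c' \<Longrightarrow> \<eta> \<le> dist c c'"
  shows "finite C"
proof (rule ccontr)
  assume "infinite C"
  then obtain l where "l islimpt C"
    using bounded_infinite_imp_islimpt[of C C] assms(1) by blast
  then have "infinite (C \<inter> ball l (\<eta> / 2))"
    using assms(2) by (simp add: islimpt_eq_infinite_ball)
  then obtain c c' where "c \<in> C \<inter> ball l (\<eta> / 2)" "c' \<in> C \<inter> ball l (\<eta> / 2)" "c \<noteq> c'"
    by (metis finite.emptyI finite_subset insert_iff subsetI finite_insert)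
  moreover from this have "dist c c' < \<eta>"
    using dist_triangle_half_r[of l c \<eta> c'] by auto
  ultimately show False
    using sep by force
qed

text \<open>Each \<open>u c\<close> is a bijection fixing the complement of its ball, hence
  preserves the ball, and the pieces form one bijection. Continuity is delicate where balls
  accumulate: disjointness and bounded centres leave only finitely many balls above any given
  radius, and the small ones move points very little.\<close>

lemma glue_isotopies_on_disjoint_balls:
  fixes C :: "'a::euclidean_space set" and u :: "'a \<Rightarrow> 'a \<Rightarrow> real \<Rightarrow> 'a"
  assumes "bounded C" and r: "\<And>c. c \<in> C \<Longrightarrow> r c > 0"
    and sep: "\<And>c c'. c \<in> C \<Longrightarrow> c' \<in> C \<Longrightarrow> c \<noteq> c' \<Longrightarrow> r c + r c' \<le> dist c c'"
    and cont: "\<And>c. c \<in> C \<Longrightarrow> continuous_on (UNIV \<times> {0..1}) (\<lambda>(x,t). u c x t)"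
    and bij: "\<And>c t. c \<in> C \<Longrightarrow> t \<in> {0..1} \<Longrightarrow> bij (\<lambda>x. u c x t)"
    and out: "\<And>c x t. c \<in> C \<Longrightarrow> x \<notin> ball c (r c) \<Longrightarrow> u c x t = x"
  obtains H :: "'a \<Rightarrow> real \<Rightarrow> 'a" where "continuous_on (UNIV \<times> {0..1}) (\<lambda>(x,t). H x t)"
    and "\<And>t. t \<in> {0..1} \<Longrightarrow> bij (\<lambda>x. H x t)"
    and "\<And>c x t. c \<in> C \<Longrightarrow> x \<in> ball c (r c) \<Longrightarrow> H x t = u c x t"
    and "\<And>c x t. c \<in> C \<Longrightarrow> x \<in> ball c (r c) \<Longrightarrow> t \<in> {0..1} \<Longrightarrow> H x t \<in> ball c (r c)"
    and "\<And>x t. x \<notin> (\<Union>c\<in>C. ball c (r c)) \<Longrightarrow> H x t = x"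
proof -
  have disj: "c = c'" if "c \<in> C" "c' \<in> C" "x \<in> ball c (r c)" "x \<in> ball c' (r c')" for c c' x
    using sep[OF that(1,2)] that(3,4) dist_triangle[of c c' x] by (force simp: dist_commute)
  define H where "H = (\<lambda>x t. if \<exists>c\<in>C. x \<in> ball c (r c) then u (THE c. c \<in> C \<and> x \<in> ball c (r c)) x t else x)"
  have H_in: "H x t = u c x t" if "c \<in> C" "x \<in> ball c (r c)" for c x t
  proof -
    have "(THE c. c \<in> C \<and> x \<in> ball c (r c)) = c"
      using that disj by (intro the_equality) auto
    then show ?thesis
      using that by (auto simp: H_def)
  qed
  have H_out: "H x t = x" if "x \<notin> (\<Union>c\<in>C. ball c (r c))" for x t
    using that by (auto simp: H_def)
  \<comment> \<open>A point outside the ball is its own value, so injectivity keeps inner points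
    from being sent there.\<close>
  have u_ball: "u c x t \<in> ball c (r c) \<longleftrightarrow> x \<in> ball c (r c)" if "c \<in> C" "t \<in> {0..1}" for c x t
    using out[OF that(1)] bij_is_inj[OF bij[OF that]] by (metis injD)
  have H_ball: "H x t \<in> ball c (r c) \<longleftrightarrow> x \<in> ball c (r c)" if "c \<in> C" "t \<in> {0..1}" for c x t
  proof (cases "\<exists>c'\<in>C. x \<in> ball c' (r c')")
    case True
    then obtain c' where "c' \<in> C" "x \<in> ball c' (r c')"
      by blast
    then have "H x t \<in> ball c' (r c')"
      using H_in u_ball that(2) by simp
    then show ?thesis
      using disj that(1) \<open>c' \<in> C\<close> \<open>x \<in> ball c' (r c')\<close> by metis
  next
    case False
    then show ?thesis
      using H_out by (metis UN_iff)
  qed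
  show thesis
  proof
    show "bij (\<lambda>x. H x t)" if t: "t \<in> {0..1}" for t
    proof (rule bijI')
      show "(H x t = H x' t) = (x = x')" for x x'
      proof
        assume eq: "H x t = H x' t"
        show "x = x'"
        proof (cases "\<exists>c\<in>C. x \<in> ball c (r c)")
          case True
          then obtain c where c: "c \<in> C" "x \<in> ball c (r c)"
            by blast
          then have "x' \<in> ball c (r c)"
            using H_ball[OF c(1) t] eq by metis
          then show ?thesis
            using H_in c eq bij_is_inj[OF bij[OF c(1) t]] by (metis injD)
        next
          case False
          then have "\<not> (\<exists>c\<in>C. x' \<in> ball c (r c))"
            using H_ball[OF _ t] eq by metis
          then show ?thesis
            using eq False H_out by (metis UN_iff)
        qed
      qed simp
      show "\<exists>x. z = H x t" for z
      proof (cases "\<exists>c\<in>C. z \<in> ball c (r c)")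
        case True
        then obtain c where c: "c \<in> C" "z \<in> ball c (r c)"
          by blast
        obtain x where "u c x t = z"
          using bij[OF c(1) t] by (metis bij_pointE)
        then show ?thesis
          using H_in c u_ball[OF c(1) t] by metis
      next
        case False
        then show ?thesis
          using H_out by (metis UN_iff)
      qed
    qed
    show "continuous_on (UNIV \<times> {0..1}) (\<lambda>(x,t). H x t)"
      unfolding continuous_on_iff
    proof (safe)
      fix x0 :: 'a and t0 \<eta> :: real
      assume t0: "t0 \<in> {0..1}" and \<eta>: "\<eta> > 0"
      have near_u: "\<exists>\<delta>>0. \<forall>x. \<forall>t\<in>{0..1}. dist (x,t) (x0,t0) < \<delta> \<longrightarrow> dist (u c x t) (u c x0 t0) < \<eta>"
        if "c \<in> C" for c
        using cont[OF that, unfolded continuous_on_iff, rule_format, of "(x0,t0)" \<eta>] t0 \<eta> by auto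
      show "\<exists>\<delta>>0. \<forall>p\<in>UNIV \<times> {0..1}. dist p (x0,t0) < \<delta> \<longrightarrow>
          dist (case p of (x,t) \<Rightarrow> H x t) (H x0 t0) < \<eta>"
      proof (cases "\<exists>c\<in>C. x0 \<in> ball c (r c)")
        case True
        then obtain c where c: "c \<in> C" "x0 \<in> ball c (r c)"
          by blast
        obtain \<delta>1 where \<delta>1: "\<delta>1 > 0" "ball x0 \<delta>1 \<subseteq> ball c (r c)"
          using c(2) open_ball open_contains_ball by metis
        obtain \<delta>2 where \<delta>2: "\<delta>2 > 0"
            "\<And>x t. t \<in> {0..1} \<Longrightarrow> dist (x,t) (x0,t0) < \<delta>2 \<Longrightarrow> dist (u c x t) (u c x0 t0) < \<eta>"
          using near_u[OF c(1)] by metis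
        have "dist (H x t) (H x0 t0) < \<eta>" if "t \<in> {0..1}" "dist (x,t) (x0,t0) < min \<delta>1 \<delta>2" for x t
        proof -
          have "dist x x0 < \<delta>1"
            using that(2) dist_fst_le[of "(x,t)" "(x0,t0)"] by simp
          then have "x \<in> ball c (r c)"
            using \<delta>1(2) by (auto simp: dist_commute)
          then show ?thesis
            using H_in c \<delta>2(2) that by simp
        qed
        then show ?thesis
          using \<delta>1(1) \<delta>2(1) by (intro exI[of _ "min \<delta>1 \<delta>2"]) auto
      next
        case False
        then have Hx0: "H x0 t0 = x0"
          using H_out by (metis UN_iff)
        \<comment> \<open>The large balls. In any other ball a point moves by less than the
          diameter, below \<open>\<eta> / 2\<close>, which leaves \<open>\<eta> / 2\<close> for the
          distance from \<open>x\<close> to \<open>x0\<close>.\<close>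
        define C1 where "C1 = {c \<in> C. r c \<ge> \<eta> / 4}"
        have "finite C1"
        proof (rule finite_bounded_separated)
          show "bounded C1"
            using assms(1) by (rule bounded_subset) (auto simp: C1_def)
          show "\<eta> / 2 \<le> dist c c'" if "c \<in> C1" "c' \<in> C1" "c \<noteq> c'" for c c'
            using sep[of c c'] that by (auto simp: C1_def)
        qed (use \<eta> in auto)
        have "\<forall>c\<in>C1. \<exists>\<delta>>0. \<forall>x. \<forall>t\<in>{0..1}. dist (x,t) (x0,t0) < \<delta> \<longrightarrow> dist (u c x t) (u c x0 t0) < \<eta>"
          using near_u by (auto simp: C1_def)
        then obtain d where d: "\<And>c. c \<in> C1 \<Longrightarrow> d c > 0"
            "\<And>c x t. c \<in> C1 \<Longrightarrow> t \<in> {0..1} \<Longrightarrow> dist (x,t) (x0,t0) < d c \<Longrightarrow> dist (u c x t) (u c x0 t0) < \<eta>"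
          by metis
        \<comment> \<open>For each of the finitely many large balls, \<open>d c\<close> comes from
          continuity of \<open>u c\<close> at \<open>(x0, t0)\<close>, where
          \<open>u c x0 t0 = x0\<close> because \<open>x0\<close> is in no ball.\<close>
        define \<delta> where "\<delta> = Min (insert (\<eta> / 2) (d ` C1))"
        have \<delta>: "\<delta> > 0" "\<delta> \<le> \<eta> / 2" "\<And>c. c \<in> C1 \<Longrightarrow> \<delta> \<le> d c"
          unfolding \<delta>_def using \<open>finite C1\<close> \<eta> d(1) by (simp, intro Min_le, simp_all)
        have "dist (H x t) x0 < \<eta>" if t: "t \<in> {0..1}" and near: "dist (x,t) (x0,t0) < \<delta>" for x t
        proof -
          have xx0: "dist x x0 < \<eta> / 2"
            using near \<delta>(2) dist_fst_le[of "(x,t)" "(x0,t0)"] by simp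
          show ?thesis
          proof (cases "\<exists>c\<in>C. x \<in> ball c (r c)")
            case True
            then obtain c where c: "c \<in> C" "x \<in> ball c (r c)"
              by blast
            show ?thesis
            proof (cases "c \<in> C1")
              case True
              then have "dist (u c x t) (u c x0 t0) < \<eta>"
                using d(2) t near \<delta>(3) by force
              moreover have "u c x0 t0 = x0"
                using out c(1) \<open>\<not> (\<exists>c\<in>C. x0 \<in> ball c (r c))\<close> by blast
              ultimately show ?thesis
                using H_in[OF c] by simp
            next
              case False
              then have "r c < \<eta> / 4"
                using c(1) by (auto simp: C1_def)
              moreover have "H x t \<in> ball c (r c)"
                using H_ball[OF c(1) t] c(2) by blast
              ultimately have "dist (H x t) x < \<eta> / 2"
                using c(2) dist_triangle[of "H x t" x c] by (simp add: dist_commute)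
              then show ?thesis
                using xx0 dist_triangle[of "H x t" x0 x] by simp
            qed
          next
            case False
            then have "H x t = x"
              using H_out by (metis UN_iff)
            then show ?thesis
              using xx0 \<eta> by simp
          qed
        qed
        then show ?thesis
          using \<delta>(1) Hx0 by (intro exI[of _ \<delta>]) auto
      qed
    qed
  qed (use H_in H_out H_ball in blast)+
qed

section \<open>Pushing polyhedra off sets with empty interior\<close>

text \<open>Invariance of domain makes the inverse continuous; the constructions of isotopies need
  only bijectivity and continuity.\<close>

lemma bij_continuous_imp_homeomorphism:
  fixes f :: "'a::euclidean_space \<Rightarrow> 'a"
  assumes "bij f" and "continuous_on UNIV f"
  obtains g where "homeomorphism UNIV UNIV f g"
  using invariance_of_domain_homeomorphism[of UNIV f] assms
  by (metis bij_is_inj bij_is_surj open_UNIV order_refl)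

text \<open>The isotopy is \<open>F x t = H (f x t) t\<close>: \<open>f\<close> translates
  \<open>P\<close> into general position, \<open>H\<close> pushes the remaining intersection points
  out of \<open>S\<close>. Each moves points by at most \<open>\<epsilon> / 2\<close>.\<close>

lemma push_off_set_with_empty_interior:
  fixes M S P :: "'a::euclidean_space set"
  assumes M: "compact M" "submanifold_with_boundary k M" and "S \<subseteq> M"
    and empty: "\<And>T. openin (top_of_set M) T \<Longrightarrow> T \<noteq> {} \<Longrightarrow> \<not> T \<subseteq> S"
    and P: "pl_polyhedron_dim P (int DIM('a) - int k)" and "\<epsilon> > 0"
  obtains F where "admissible_isotopy P S \<epsilon> F" and "(\<lambda>x. F x 1) ` P \<inter> S = {}"
proof -

  \<comment> \<open>Translation of the polyhedron into general position\<close>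
  obtain \<T> where \<T>: "finite \<T>" "P = \<Union>\<T>" "\<And>T. T \<in> \<T> \<Longrightarrow> \<exists>n\<le>int DIM('a) - int k. n simplex T"
    using P unfolding pl_polyhedron_dim_def by blast
  have cpt: "compact T" and dimT: "aff_dim T \<le> int DIM('a) - int k" if "T \<in> \<T>" for T
    using \<T>(3)[OF that] compact_simplex aff_dim_simplex by auto
  have "bounded (P \<inter> S)"
    using M(1) \<open>S \<subseteq> M\<close> by (meson bounded_subset compact_imp_bounded inf.coboundedI2)
  then obtain \<beta> K B where \<beta>: "\<And>x. \<beta> differentiable (at x)" and "K \<ge> 0"
    and lip: "\<And>x y. \<bar>\<beta> x - \<beta> y\<bar> \<le> K * dist x y" and nonneg: "\<And>x. \<beta> x \<ge> 0" and B: "\<And>x. \<beta> x \<le> B"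
    and pos: "\<And>x. x \<in> P \<inter> S \<Longrightarrow> \<beta> x > 0" and zero: "\<And>x. x \<notin> nbhd (P \<inter> S) \<epsilon> \<Longrightarrow> \<beta> x = 0"
    using differentiable_Lipschitz_cutoff[OF _ \<open>\<epsilon> > 0\<close>] by metis
  have "B \<ge> 0"
    using nonneg B order_trans by blast
  \<comment> \<open>The first bound makes the translation a bijection, the second limits its
    displacement to \<open>\<epsilon> / 2\<close>. Adding 1 keeps the denominators positive.\<close>
  define \<delta> where "\<delta> = min (1 / (K + 1)) (\<epsilon> / (2 * (B + 1)))"
  have "\<delta> > 0"
    using \<open>K \<ge> 0\<close> \<open>B \<ge> 0\<close> \<open>\<epsilon> > 0\<close> by (simp add: \<delta>_def)
  obtain v where v: "norm v < \<delta>"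
    and interior: "\<And>x. x \<in> \<Union>\<T> \<Longrightarrow> \<beta> x > 0 \<Longrightarrow> x + \<beta> x *\<^sub>R v \<in> M \<Longrightarrow>
      \<exists>U V \<phi> \<psi> E e. boundary_chart k M U V \<phi> \<psi> E e \<and> x + \<beta> x *\<^sub>R v \<in> U \<and> \<phi> (x + \<beta> x *\<^sub>R v) \<bullet> e > 0"
    and isolated: "\<And>T x. T \<in> \<T> \<Longrightarrow> x \<in> T \<Longrightarrow> \<beta> x > 0 \<Longrightarrow> x + \<beta> x *\<^sub>R v \<in> M \<Longrightarrow>
      \<exists>\<eta>>0. \<forall>x'\<in>T. dist x' x < \<eta> \<longrightarrow> \<beta> x' > 0 \<longrightarrow> x' + \<beta> x' *\<^sub>R v \<in> M \<longrightarrow>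
        x' + \<beta> x' *\<^sub>R v = x + \<beta> x *\<^sub>R v"
    using generic_manifold_intersection[OF M \<T>(1) dimT \<beta> \<open>\<delta> > 0\<close>] by blast
  have "norm v < 1 / (K + 1)" "norm v < \<epsilon> / (2 * (B + 1))"
    using v by (auto simp: \<delta>_def)
  then have "(K + 1) * norm v < 1" "(B + 1) * norm v < \<epsilon> / 2"
    using \<open>K \<ge> 0\<close> \<open>B \<ge> 0\<close> by (auto simp: field_simps)
  then have Kv: "K * norm v < 1" and Bv: "B * norm v < \<epsilon> / 2"
    using norm_ge_zero[of v] unfolding distrib_right by linarith+
  define f where "f = (\<lambda>x t. x + (t * \<beta> x) *\<^sub>R v)"
  have bijf: "bij (\<lambda>x. f x t)" if "t \<in> {0..1}" for t
    unfolding f_def by (rule cutoff_translation_bij[OF lip \<open>K \<ge> 0\<close> Kv that])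
  have \<beta>f: "\<beta> (f x t) = 0 \<longleftrightarrow> \<beta> x = 0" if "t \<in> {0..1}" for x t
    using cutoff_translation_support[OF bijf[OF that, unfolded f_def]] by (simp add: f_def)
  have cont\<beta>: "continuous_on X \<beta>" for X
    using \<beta> by (simp add: continuous_at_imp_continuous_on differentiable_imp_continuous_within)
  have contf: "continuous_on X (\<lambda>p. f (fst p) (snd p))" for X
    unfolding f_def by (intro continuous_intros continuous_on_compose2[OF cont\<beta>[of UNIV]]) auto
  have contf1: "continuous_on X (\<lambda>x. f x t)" for X t
    unfolding f_def by (intro continuous_intros cont\<beta>)
  have f_dist: "norm (f x t - x) \<le> \<epsilon> / 2" if "t \<in> {0..1}" for x t
  proof -
    have "norm (f x t - x) = t * (\<beta> x * norm v)"
      using that nonneg by (simp add: f_def abs_mult)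
    also have "\<dots> \<le> 1 * (B * norm v)"
      using that nonneg B \<open>B \<ge> 0\<close> by (intro mult_mono) auto
    finally show ?thesis
      using Bv by simp
  qed
  obtain g where g: "homeomorphism UNIV UNIV (\<lambda>x. f x 1) g"
    using bij_continuous_imp_homeomorphism[OF bijf[of 1] contf1] by auto
  have f1: "f x 1 = x + \<beta> x *\<^sub>R v" for x
    by (simp add: f_def)

  \<comment> \<open>The discrete set of intersection points\<close>
  define W where "W = {x. \<beta> x > 0}"
  have fW: "f x t \<in> W \<longleftrightarrow> x \<in> W" if "t \<in> {0..1}" for x t
    using \<beta>f[OF that, of x] nonneg[of x] nonneg[of "f x t"] by (auto simp: W_def)
  have "open W"
    unfolding W_def using cont\<beta> by (intro open_Collect_less continuous_intros)
  define C where "C = (\<lambda>T. {c \<in> M. c \<in> W \<and> c \<in> (\<lambda>x. f x 1) ` T})"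
  \<comment> \<open>If \<open>c\<close> is on the translated \<open>T\<close>, the inverse
    \<open>g\<close> carries nearby points of \<open>C T\<close> back near the preimage of
    \<open>c\<close>, where solutions are isolated; otherwise the compact translate of
    \<open>T\<close> stays away from \<open>c\<close>. Accumulation on the frontier of
    \<open>W\<close> remains possible.\<close>
  have no_limpt: "\<forall>\<^sub>F z in at c. z \<notin> C T" if T: "T \<in> \<T>" and c: "c \<in> W" "c \<in> M" for T c
  proof (cases "c \<in> (\<lambda>x. f x 1) ` T")
    case True
    then obtain x where x: "x \<in> T" "c = f x 1"
      by blast
    have "\<beta> x > 0"
      using fW[of 1 x] c(1) x(2) by (simp add: W_def)
    then obtain \<eta> where \<eta>: "\<eta> > 0" "\<And>x'. x' \<in> T \<Longrightarrow> dist x' x < \<eta> \<Longrightarrow> \<beta> x' > 0 \<Longrightarrow> f x' 1 \<in> M \<Longrightarrow> f x' 1 = c"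
      using isolated[OF T x(1)] c(2) x(2) unfolding f1 by metis
    have "g c = x"
      using homeomorphism_apply1[OF g] x(2) by simp
    have "isCont g c"
      using homeomorphism_cont2[OF g] continuous_on_eq_continuous_at by blast
    then have "\<forall>\<^sub>F z in at c. dist (g z) x < \<eta>"
      using \<eta>(1) \<open>g c = x\<close> unfolding isCont_def by (metis tendstoD)
    then show ?thesis
      using eventually_neq_at_within[of c c UNIV]
    proof eventually_elim
      case (elim z)
      show ?case
      proof
        assume "z \<in> C T"
        then obtain x' where x': "x' \<in> T" "z = f x' 1" "z \<in> M" "z \<in> W"
          by (auto simp: C_def)
        have "g z = x'"
          using homeomorphism_apply1[OF g] x'(2) by simp
        moreover have "\<beta> x' > 0"
          using fW[of 1 x'] x' by (simp add: W_def)
        ultimately show False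
          using \<eta>(2)[of x'] elim x' by auto
      qed
    qed
  next
    case False
    have "closed ((\<lambda>x. f x 1) ` T)"
      using compact_continuous_image[OF contf1 cpt[OF T]] compact_imp_closed by blast
    then have "\<forall>\<^sub>F z in at c. z \<in> - (\<lambda>x. f x 1) ` T"
      using False by (intro eventually_at_in_open') auto
    then show ?thesis
      by eventually_elim (auto simp: C_def)
  qed
  define D where "D = (\<Union>T\<in>\<T>. C T)"
  have D_iff: "c \<in> D \<longleftrightarrow> c \<in> M \<and> c \<in> W \<and> c \<in> (\<lambda>x. f x 1) ` P" for c
    by (auto simp: D_def C_def \<T>(2))
  \<comment> \<open>A radius of at most half the distance to every other point makes any two balls
    disjoint; \<open>\<epsilon> / 4\<close> limits the push to the diameter
    \<open>\<epsilon> / 2\<close>, and staying in \<open>W\<close> respects the support.\<close>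
  have "\<exists>\<rho>>0. \<rho> \<le> \<epsilon> / 4 \<and> ball c \<rho> \<subseteq> W \<and> (\<forall>c'\<in>D. c' \<noteq> c \<longrightarrow> 2 * \<rho> \<le> dist c' c)" if "c \<in> D" for c
  proof -
    have c: "c \<in> W" "c \<in> M"
      using that D_iff by auto
    have "\<forall>\<^sub>F z in at c. \<forall>T\<in>\<T>. z \<notin> C T"
      using \<T>(1) no_limpt[OF _ c] by (simp add: eventually_ball_finite_distrib)
    then obtain d where d: "d > 0" "\<And>z. z \<noteq> c \<Longrightarrow> dist z c < d \<Longrightarrow> z \<notin> D"
      unfolding eventually_at D_def by auto
    obtain e where e: "e > 0" "ball c e \<subseteq> W"
      using \<open>open W\<close> c(1) open_contains_ball by blast
    define \<rho> where "\<rho> = min (d / 2) (min e (\<epsilon> / 4))"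
    have "\<rho> > 0" "\<rho> \<le> \<epsilon> / 4" "\<rho> \<le> e" "2 * \<rho> \<le> d"
      using d(1) e(1) \<open>\<epsilon> > 0\<close> by (auto simp: \<rho>_def)
    moreover have "ball c \<rho> \<subseteq> W"
      using e(2) \<open>\<rho> \<le> e\<close> subset_ball by blast
    moreover have "2 * \<rho> \<le> dist c' c" if "c' \<in> D" "c' \<noteq> c" for c'
      using d(2)[OF that(2)] that(1) \<open>2 * \<rho> \<le> d\<close> by force
    ultimately show ?thesis
      by blast
  qed
  then obtain r where r: "\<And>c. c \<in> D \<Longrightarrow> r c > 0" "\<And>c. c \<in> D \<Longrightarrow> r c \<le> \<epsilon> / 4"
      "\<And>c. c \<in> D \<Longrightarrow> ball c (r c) \<subseteq> W" "\<And>c c'. c \<in> D \<Longrightarrow> c' \<in> D \<Longrightarrow> c' \<noteq> c \<Longrightarrow> 2 * r c \<le> dist c' c"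
    by metis
  have sep: "r c + r c' \<le> dist c c'" if "c \<in> D" "c' \<in> D" "c \<noteq> c'" for c c'
    using r(4)[OF that(1,2)] r(4)[OF that(2,1)] that(3) by (simp add: dist_commute)

  \<comment> \<open>Local pushes combined into one isotopy\<close>
  define push where "push = (\<lambda>c u. continuous_on (UNIV \<times> {0..1}) (\<lambda>(x,t). u x t) \<and>
      (\<forall>t. t \<in> {0..1} \<longrightarrow> bij (\<lambda>x. u x t)) \<and> (\<forall>x. u x 0 = x) \<and>
      (\<forall>x t. x \<notin> ball c (r c) \<longrightarrow> u x t = x) \<and>
      (\<forall>x t. t \<in> {0..1} \<longrightarrow> (u x t \<in> M \<longleftrightarrow> x \<in> M)) \<and> u c (1::real) \<notin> S)"
  have "\<exists>u. push c u" if c: "c \<in> D" for c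
  proof -
    obtain x where x: "x \<in> \<Union>\<T>" "c = x + \<beta> x *\<^sub>R v" "c \<in> M" "c \<in> W"
      using c D_iff[of c] \<T>(2) f1 by auto
    have "\<beta> x > 0"
      using fW[of 1 x] x(2,4) f1 by (simp add: W_def)
    then obtain U V \<phi> \<psi> E e where chart: "boundary_chart k M U V \<phi> \<psi> E e" "c \<in> U" "\<phi> c \<bullet> e > 0"
      using interior[OF x(1)] x(2,3) by metis
    then have ch: "homeomorphism U V \<phi> \<psi>" "open U" "open V" "subspace E"
        "\<phi> ` (U \<inter> M) = V \<inter> {y \<in> E. y \<bullet> e \<ge> 0}"
      by (auto simp: boundary_chart_def diffeo_between_def)
    show ?thesis
      by (rule chart_point_push[OF ch chart(2) x(3) chart(3) r(1)[OF c] empty])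
         (assumption+, unfold push_def, rule exI, intro conjI allI impI)
  qed
  then obtain u where "\<And>c. c \<in> D \<Longrightarrow> push c (u c)"
    by metis
  then have u:
      "\<And>c. c \<in> D \<Longrightarrow> continuous_on (UNIV \<times> {0..1}) (\<lambda>(x,t). u c x t)"
      "\<And>c t. c \<in> D \<Longrightarrow> t \<in> {0..1} \<Longrightarrow> bij (\<lambda>x. u c x t)"
      "\<And>c x. c \<in> D \<Longrightarrow> u c x 0 = x"
      "\<And>c x t. c \<in> D \<Longrightarrow> x \<notin> ball c (r c) \<Longrightarrow> u c x t = x"
      "\<And>c x t. c \<in> D \<Longrightarrow> t \<in> {0..1} \<Longrightarrow> u c x t \<in> M \<longleftrightarrow> x \<in> M"
      "\<And>c. c \<in> D \<Longrightarrow> u c c 1 \<notin> S"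
    unfolding push_def by blast+
  have "bounded D"
    using M(1) D_iff by (meson bounded_subset compact_imp_bounded subsetI)
  then obtain H :: "'a \<Rightarrow> real \<Rightarrow> 'a" where H: "continuous_on (UNIV \<times> {0..1}) (\<lambda>(x,t). H x t)"
    "\<And>t. t \<in> {0..1} \<Longrightarrow> bij (\<lambda>x. H x t)"
    "\<And>c x t. c \<in> D \<Longrightarrow> x \<in> ball c (r c) \<Longrightarrow> H x t = u c x t"
    "\<And>c x t. c \<in> D \<Longrightarrow> x \<in> ball c (r c) \<Longrightarrow> t \<in> {0..1} \<Longrightarrow> H x t \<in> ball c (r c)"
    "\<And>x t. x \<notin> (\<Union>c\<in>D. ball c (r c)) \<Longrightarrow> H x t = x"
    using glue_isotopies_on_disjoint_balls[of D r u] r(1) sep u(1,2,4) by blast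
  have H_W: "H x t = x" if "x \<notin> W" for x t
    using that r(3) by (intro H(5)) blast
  have H_0: "H x 0 = x" for x
  proof (cases "\<exists>c\<in>D. x \<in> ball c (r c)")
    case True
    then show ?thesis
      using H(3) u(3) by force
  next
    case False
    then show ?thesis
      by (intro H(5)) auto
  qed
  have H_dist: "norm (H x t - x) \<le> \<epsilon> / 2" if "t \<in> {0..1}" for x t
  proof (cases "\<exists>c\<in>D. x \<in> ball c (r c)")
    case True
    then obtain c where c: "c \<in> D" "x \<in> ball c (r c)"
      by blast
    have "dist (H x t) x \<le> dist c (H x t) + dist c x"
      using dist_triangle3 by (metis add.commute dist_commute)
    also have "\<dots> \<le> \<epsilon> / 4 + \<epsilon> / 4"
      using H(4)[OF c that] c(2) r(2)[OF c(1)] by (intro add_mono) auto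
    finally show ?thesis
      by (simp add: dist_norm)
  next
    case False
    then have "H x t = x"
      by (intro H(5)) auto
    then show ?thesis
      using \<open>\<epsilon> > 0\<close> by simp
  qed
  have H_M: "H x 1 \<in> M \<longleftrightarrow> x \<in> M" for x
  proof (cases "\<exists>c\<in>D. x \<in> ball c (r c)")
    case True
    then show ?thesis
      using H(3) u(5) by force
  next
    case False
    then have "H x 1 = x"
      by (intro H(5)) auto
    then show ?thesis
      by simp
  qed

  \<comment> \<open>The composite isotopy and its effect on the polyhedron\<close>
  define F where "F = (\<lambda>x t. H (f x t) t)"
  have contF: "continuous_on (UNIV \<times> {0..1}) (\<lambda>p. F (fst p) (snd p))"
  proof -
    have "continuous_on (UNIV \<times> {0..1}) (\<lambda>p. (f (fst p) (snd p), snd p))"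
      by (intro continuous_on_Pair contf continuous_intros)
    then have "continuous_on (UNIV \<times> {0..1}) (\<lambda>p. (\<lambda>(x,t). H x t) (f (fst p) (snd p), snd p))"
      by (rule continuous_on_compose2[OF H(1)]) auto
    then show ?thesis
      by (simp add: F_def)
  qed
  show thesis
  proof
    show "admissible_isotopy P S \<epsilon> F"
      unfolding admissible_isotopy_def
    proof (intro conjI ballI allI impI)
      show "continuous_on (UNIV \<times> {0..1}) (\<lambda>(x,t). F x t)"
        using contF by (simp add: case_prod_unfold)
      show "F x 0 = x" for x
        by (simp add: F_def f_def H_0)
      fix t :: real assume t: "t \<in> {0..1}"
      have "bij (\<lambda>x. F x t)"
        using bij_comp[OF bijf[OF t] H(2)[OF t]] by (simp add: F_def o_def)
      moreover have "continuous_on UNIV (\<lambda>x. F x t)"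
        using continuous_on_compose2[OF contF, of UNIV "\<lambda>x. (x,t)"] t by (force intro: continuous_intros)
      ultimately show "\<exists>g. homeomorphism UNIV UNIV (\<lambda>x. F x t) g"
        using bij_continuous_imp_homeomorphism by metis
      show "norm (F x t - x) \<le> \<epsilon>" for x
        using norm_triangle_ineq[of "H (f x t) t - f x t" "f x t - x"] H_dist[OF t, of "f x t"] f_dist[OF t, of x]
        by (simp add: F_def)
      show "F x t = x" if "x \<notin> nbhd (P \<inter> S) \<epsilon>" for x
      proof -
        have "f x t = x" "x \<notin> W"
          using zero[OF that] by (auto simp: f_def W_def)
        then show ?thesis
          by (simp add: F_def H_W)
      qed
    qed
    show "(\<lambda>x. F x 1) ` P \<inter> S = {}"
    proof (rule ccontr)
      assume "(\<lambda>x. F x 1) ` P \<inter> S \<noteq> {}"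
      then obtain x where x: "x \<in> P" "H (f x 1) 1 \<in> S"
        by (auto simp: F_def)
      \<comment> \<open>At time 1 \<open>H\<close> preserves \<open>M\<close> and its complement, so
        a point ending in \<open>S\<close> was already in \<open>M\<close> after the translation.
        Inside \<open>W\<close> it is then a centre in \<open>D\<close>, whose push leaves
        \<open>S\<close>; outside \<open>W\<close> it never moved, yet \<open>\<beta>\<close> is
        positive on \<open>P \<inter> S\<close>.\<close>
      have fM: "f x 1 \<in> M"
        using x(2) \<open>S \<subseteq> M\<close> H_M by blast
      show False
      proof (cases "x \<in> W")
        case True
        then have "f x 1 \<in> D"
          using D_iff fM fW[of 1 x] x(1) by auto
        then have "H (f x 1) 1 = u (f x 1) (f x 1) 1"
          using r(1) by (intro H(3)) auto
        then show False
          using u(6) x(2) \<open>f x 1 \<in> D\<close> by simp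
      next
        case False
        then have "\<beta> x = 0"
          using nonneg[of x] by (simp add: W_def)
        then have "f x 1 = x"
          by (simp add: f_def)
        then have "x \<in> P \<inter> S"
          using x H_W False by simp
        then show False
          using pos False by (auto simp: W_def)
      qed
    qed
  qed
qed

theorem mainTheorem6:
  fixes M S :: "'a::euclidean_space set" and k :: nat
  assumes "1 \<le> k" and "k \<le> DIM('a)"
    and "compact M" and "submanifold_with_boundary k M"
    and "S \<subseteq> M"
    and "dem_eq S (int k)"
  shows "\<exists>T. T \<noteq> {} \<and> openin (top_of_set M) T \<and> T \<subseteq> S"
proof (rule ccontr)
  assume none: "\<not> ?thesis"
  \<comment> \<open>The witness of the demension is a polyhedron of codimension \<open>k\<close>
    that no admissible isotopy frees from \<open>S\<close>.\<close>
  obtain P \<epsilon> where P: "pl_polyhedron_dim P (int DIM('a) - int k)" and "\<epsilon> > 0"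
    and stable: "\<And>F. admissible_isotopy P S \<epsilon> F \<Longrightarrow> (\<lambda>x. F x 1) ` P \<inter> S \<noteq> {}"
    using assms(6) unfolding dem_eq_def dem_prop_def by blast
  obtain F where "admissible_isotopy P S \<epsilon> F" "(\<lambda>x. F x 1) ` P \<inter> S = {}"
    using push_off_set_with_empty_interior[OF assms(3-5) _ P \<open>\<epsilon> > 0\<close>] none by metis
  then show False
    using stable by blast
qed

end
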